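(* Let $\mathscr{A}$ be a $C^*$-algebra, $\mathscr{H}$ a Hilbert $\mathscr{A}$-module, and let $A\in\mathcal{L}(\mathscr{H})$ have the polar decomposition $A=U|A|$. Then the following statements are equivalent: (i) $A$ is semi-hyponormal. (ii) $\|\langle Ax,y\rangle\|\le\big\||A|^{1/2}x\big\|\,\big\||A|^{1/2}y\big\|$ for all $x,y\in\mathscr{H}$.
   Context: $\mathcal{L}(\mathscr{H})$ is the $C^*$-algebra of adjointable operators on the Hilbert $C^*$-module $(\mathscr{H},\langle\cdot,\cdot\rangle)$, with norm $\|x\|=\|\langle x,x\rangle\|^{1/2}$ on $\mathscr{H}$. $\mathcal{R}(\cdot)$ and $\mathcal{N}(\cdot)$ denote range and null space, and $|A|=(A^*A)^{1/2}$. An element $U\in\mathcal{L}(\mathscr{H})$ is a partial isometry if $U^*U$ is a projection in $\mathcal{L}(\mathscr{H})$. $A$ has the polar decomposition $A=U|A|$ if this equality holds with $U\in\mathcal{L}(\mathscr{H})$ a partial isometry such that $\mathcal{N}(U)=\mathcal{N}(A)$, $\mathcal{N}(U^* )=\mathcal{N}(A^* )$, $\mathcal{R}(U)=\overline{\mathcal{R}(A)}$, $\mathcal{R}(U^* )=\overline{\mathcal{R}(A^* )}$ (such a $U$ need not exist for a general adjointable $A$). $A$ is semi-hyponormal if $|A^*|\le|A|$ in $\mathcal{L}(\mathscr{H})$. *)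

theory Defs
  imports "HOL-Analysis.Analysis"
begin

class complex_vector = real_vector +
  fixes scaleC :: "complex \<Rightarrow> 'a \<Rightarrow> 'a" (infixr "*\<^sub>C" 75)
  assumes scaleC_add_right: "c *\<^sub>C (x + y) = c *\<^sub>C x + c *\<^sub>C y"
    and scaleC_add_left: "(c + d) *\<^sub>C x = c *\<^sub>C x + d *\<^sub>C x"
    and scaleC_scaleC: "c *\<^sub>C (d *\<^sub>C x) = (c * d) *\<^sub>C x"
    and scaleC_of_real: "complex_of_real r *\<^sub>C x = r *\<^sub>R x"

class complex_normed_vector = complex_vector + real_normed_vector +
  assumes norm_scaleC: "norm (c *\<^sub>C x) = cmod c * norm x"

text \<open>A unit is not required.\<close>

class cstar_algebra = complex_normed_vector + real_normed_algebra + banach +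
  fixes star :: "'a \<Rightarrow> 'a"
  assumes mult_scaleC_left: "(c *\<^sub>C a) * b = c *\<^sub>C (a * b)"
    and mult_scaleC_right: "a * (c *\<^sub>C b) = c *\<^sub>C (a * b)"
    and star_star: "star (star a) = a"
    and star_add: "star (a + b) = star a + star b"
    and star_scaleC: "star (c *\<^sub>C a) = cnj c *\<^sub>C star a"
    and star_mult: "star (a * b) = star b * star a"
    and cstar_identity: "norm (star a * a) = (norm a)\<^sup>2"

text \<open>The product of the unitization, where \<open>(a, c)\<close> stands for \<open>a + c 1\<close> and the unit
  is \<open>(0, 1)\<close>. The spectrum is the one computed in the unitization; it always contains
  \<open>0\<close>, so for an algebra with unit it is the usual spectrum with \<open>0\<close> adjoined. This
  makes no difference to whether it consists of nonnegative numbers.\<close>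

fun unitization_mult ::
  "'a::cstar_algebra \<times> complex \<Rightarrow> 'a \<times> complex \<Rightarrow> 'a \<times> complex" where
  "unitization_mult (a, c) (b, d) = (a * b + c *\<^sub>C b + d *\<^sub>C a, c * d)"

definition spectrum :: "'a::cstar_algebra \<Rightarrow> complex set" where
  "spectrum a =
    {z. \<not> (\<exists>w. unitization_mult (a, - z) w = (0, 1) \<and> unitization_mult w (a, - z) = (0, 1))}"

definition positive :: "'a::cstar_algebra \<Rightarrow> bool" where
  "positive a \<longleftrightarrow> star a = a \<and> spectrum a \<subseteq> complex_of_real ` {0..}"

text \<open>Right modules, with the inner product linear in the second argument. Completeness is
  part of the sort of \<open>'h\<close>, whose norm is tied to the inner product by \<open>norm_eq\<close>.\<close>

locale hilbert_module =
  fixes act :: "'h::{complex_normed_vector, banach} \<Rightarrow> 'a::cstar_algebra \<Rightarrow> 'h"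
    and ip :: "'h \<Rightarrow> 'h \<Rightarrow> 'a"
  assumes act_add_left: "act (x + y) a = act x a + act y a"
    and act_add_right: "act x (a + b) = act x a + act x b"
    and act_mult: "act x (a * b) = act (act x a) b"
    and act_scaleC_left: "act (c *\<^sub>C x) a = c *\<^sub>C act x a"
    and act_scaleC_right: "act x (c *\<^sub>C a) = c *\<^sub>C act x a"
    and ip_add_right: "ip x (y + z) = ip x y + ip x z"
    and ip_scaleC_right: "ip x (c *\<^sub>C y) = c *\<^sub>C ip x y"
    and ip_act_right: "ip x (act y a) = ip x y * a"
    and star_ip: "star (ip x y) = ip y x"
    and ip_positive: "positive (ip x x)"
    and ip_definite: "ip x x = 0 \<Longrightarrow> x = 0"
    and norm_eq: "norm x = sqrt (norm (ip x x))"

text \<open>A map with an adjoint is automatically linear over the scalars and the algebra, and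
  bounded; the adjoint is unique.\<close>

definition adjointable :: "('h \<Rightarrow> 'h \<Rightarrow> 'a) \<Rightarrow> ('h \<Rightarrow> 'h) set" where
  "adjointable ip = {T. \<exists>S. \<forall>x y. ip (T x) y = ip x (S y)}"

definition adj :: "('h \<Rightarrow> 'h \<Rightarrow> 'a) \<Rightarrow> ('h \<Rightarrow> 'h) \<Rightarrow> ('h \<Rightarrow> 'h)" where
  "adj ip T = (THE S. \<forall>x y. ip (T x) y = ip x (S y))"

text \<open>Spectrum, positivity, order and square root are those of the unital C*-algebra of
  adjointable operators.\<close>

definition op_spectrum ::
  "('h::complex_normed_vector \<Rightarrow> 'h \<Rightarrow> 'a) \<Rightarrow> ('h \<Rightarrow> 'h) \<Rightarrow> complex set" where
  "op_spectrum ip T =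
    {z. \<not> (\<exists>S\<in>adjointable ip. (\<lambda>x. T x - z *\<^sub>C x) \<circ> S = id \<and> S \<circ> (\<lambda>x. T x - z *\<^sub>C x) = id)}"

definition op_positive ::
  "('h::complex_normed_vector \<Rightarrow> 'h \<Rightarrow> 'a) \<Rightarrow> ('h \<Rightarrow> 'h) \<Rightarrow> bool" where
  "op_positive ip T \<longleftrightarrow>
    T \<in> adjointable ip \<and> adj ip T = T \<and> op_spectrum ip T \<subseteq> complex_of_real ` {0..}"

definition op_le ::
  "('h::complex_normed_vector \<Rightarrow> 'h \<Rightarrow> 'a) \<Rightarrow> ('h \<Rightarrow> 'h) \<Rightarrow> ('h \<Rightarrow> 'h) \<Rightarrow> bool" where
  "op_le ip S T \<longleftrightarrow>
    S \<in> adjointable ip \<and> T \<in> adjointable ip \<and> op_positive ip (\<lambda>x. T x - S x)"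

definition op_sqrt ::
  "('h::complex_normed_vector \<Rightarrow> 'h \<Rightarrow> 'a) \<Rightarrow> ('h \<Rightarrow> 'h) \<Rightarrow> ('h \<Rightarrow> 'h)" where
  "op_sqrt ip T = (THE S. op_positive ip S \<and> S \<circ> S = T)"

definition op_abs ::
  "('h::complex_normed_vector \<Rightarrow> 'h \<Rightarrow> 'a) \<Rightarrow> ('h \<Rightarrow> 'h) \<Rightarrow> ('h \<Rightarrow> 'h)" where
  "op_abs ip A = op_sqrt ip (adj ip A \<circ> A)"

definition projection :: "('h \<Rightarrow> 'h \<Rightarrow> 'a) \<Rightarrow> ('h \<Rightarrow> 'h) \<Rightarrow> bool" where
  "projection ip P \<longleftrightarrow> P \<in> adjointable ip \<and> adj ip P = P \<and> P \<circ> P = P"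

definition partial_isometry :: "('h \<Rightarrow> 'h \<Rightarrow> 'a) \<Rightarrow> ('h \<Rightarrow> 'h) \<Rightarrow> bool" where
  "partial_isometry ip U \<longleftrightarrow> U \<in> adjointable ip \<and> projection ip (adj ip U \<circ> U)"

definition null_space :: "('h::zero \<Rightarrow> 'h) \<Rightarrow> 'h set" where
  "null_space T = {x. T x = 0}"

definition polar_decomposition ::
  "('h::complex_normed_vector \<Rightarrow> 'h \<Rightarrow> 'a) \<Rightarrow> ('h \<Rightarrow> 'h) \<Rightarrow> ('h \<Rightarrow> 'h) \<Rightarrow> bool" where
  "polar_decomposition ip A U \<longleftrightarrow>
    A = U \<circ> op_abs ip A \<and> partial_isometry ip U \<and>
    null_space U = null_space A \<and> null_space (adj ip U) = null_space (adj ip A) \<and>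
    range U = closure (range A) \<and> range (adj ip U) = closure (range (adj ip A))"

definition semi_hyponormal ::
  "('h::complex_normed_vector \<Rightarrow> 'h \<Rightarrow> 'a) \<Rightarrow> ('h \<Rightarrow> 'h) \<Rightarrow> bool" where
  "semi_hyponormal ip A \<longleftrightarrow> op_le ip (op_abs ip (adj ip A)) (op_abs ip A)"

end

theory Submission
  imports Defs
begin

text \<open>
  Put \<open>T = |A|\<^bsup>1/2\<^esup>\<close> and \<open>V = T U*\<close>. Then \<open>\<langle>A x, y\<rangle> = \<langle>T x, V y\<rangle>\<close>, because \<open>A = U T T\<close>, and
  \<open>V* V = U |A| U* = |A*|\<close> (\<open>polar_decompositionE\<close>). Hence semi-hyponormality says
  \<open>V* V \<le> T T\<close>, which is the same as \<open>\<parallel>V y\<parallel> \<le> \<parallel>T y\<parallel>\<close> for all \<open>y\<close> (\<open>norm_le_iff_pos_diff\<close>).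
  If this holds, then the norm inequality of the theorem is the Cauchy-Schwarz inequality for \<open>T x\<close> and
  \<open>V y\<close>. Conversely, at \<open>x = U* y\<close> it reads \<open>\<parallel>V y\<parallel>\<^sup>2 \<le> \<parallel>V y\<parallel> \<parallel>T y\<parallel>\<close>.

  The rest is the theory behind these few lines. Positivity is a condition on spectra, once in
  the algebra (through its unitization) and once in the adjointable operators. Both cases reduce
  to bounded operators on a Banach space: an element of the algebra acts on the algebra by left
  multiplication, an adjointable operator acts on the module. In both cases the self-adjoint
  elements satisfy \<open>\<parallel>h + i t\<parallel>\<^sup>2 \<le> \<parallel>h\<^sup>2 + t\<^sup>2\<parallel>\<close> for real \<open>t\<close> (\<open>symmetric_family\<close>). This inequality makes
  their spectra real and makes the norm the modulus of a spectral value, the latter through a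
  spectral radius theorem (\<open>spectral_radius_attained\<close>). So \<open>h\<close> is positive if and only if
  \<open>\<parallel>t - h\<parallel> \<le> t\<close> for \<open>t = \<parallel>h\<parallel>\<close>; sums of positive elements are therefore positive, and norms of
  positive elements are monotone.

  In the algebra this gives \<open>\<parallel>p\<parallel> \<le> \<parallel>p + q\<parallel>\<close> and \<open>\<parallel>p - q\<parallel> \<le> max \<parallel>p\<parallel> \<parallel>q\<parallel>\<close> for positive \<open>p\<close> and \<open>q\<close>. These
  two inequalities yield the Cauchy-Schwarz inequality in the module and the positivity of
  \<open>X* X\<close> for adjointable \<open>X\<close>. Positive operators have unique positive square roots
  (\<open>pos_sqrt\<close>, \<open>pos_sqrt_unique\<close>), so the absolute values and roots in the theorem exist and
  can be computed by exhibiting a positive operator with the right square.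
\<close>

section \<open>Complex scalars\<close>

lemma scaleC_one [simp]: "1 *\<^sub>C x = (x::'a::complex_vector)"
  using scaleC_of_real[of 1 x] by simp

lemma scaleC_zero_left [simp]: "0 *\<^sub>C x = (0::'a::complex_vector)"
  using scaleC_of_real[of 0 x] by simp

lemma scaleC_zero_right [simp]: "c *\<^sub>C 0 = (0::'a::complex_vector)"
  using scaleC_add_right[of c 0 0] by simp

lemma scaleC_minus_left [simp]: "(- c) *\<^sub>C x = - (c *\<^sub>C (x::'a::complex_vector))"
  using scaleC_add_left[of "-c" c x] by (simp add: add_eq_0_iff2)

lemma scaleC_minus_right [simp]: "c *\<^sub>C (- x) = - (c *\<^sub>C (x::'a::complex_vector))"
  using scaleC_add_right[of c "-x" x] by (simp add: add_eq_0_iff2)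

lemma scaleC_diff_left: "(c - d) *\<^sub>C x = c *\<^sub>C x - d *\<^sub>C (x::'a::complex_vector)"
  using scaleC_add_left[of c "-d" x] by simp

lemma scaleC_diff_right: "c *\<^sub>C (x - y) = c *\<^sub>C x - c *\<^sub>C (y::'a::complex_vector)"
  using scaleC_add_right[of c x "-y"] by simp

section \<open>Unital complex Banach algebras\<close>

text \<open>The unit may be zero, as it is for the operators on the trivial space; this is why the class
  extends \<^class>\<open>monoid_mult\<close> and not \<^class>\<open>ring_1\<close>, and bounds the norm of the unit only from above.\<close>

class unital_banach_algebra = complex_normed_vector + real_normed_algebra + monoid_mult + banach +
  assumes scaleC_times_left: "(c *\<^sub>C a) * b = c *\<^sub>C (a * b)"
    and scaleC_times_right: "a * (c *\<^sub>C b) = c *\<^sub>C (a * b)"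
    and norm_one_le: "norm 1 \<le> 1"

definition inverse_pair :: "'b::unital_banach_algebra \<Rightarrow> 'b \<Rightarrow> bool" where
  "inverse_pair a b \<longleftrightarrow> a * b = 1 \<and> b * a = 1"

definition alg_spectrum :: "'b::unital_banach_algebra \<Rightarrow> complex set" where
  "alg_spectrum a = {z. \<not> (\<exists>b. inverse_pair (a - z *\<^sub>C 1) b)}"

lemma inverse_pair_sym: "inverse_pair a b \<Longrightarrow> inverse_pair b a"
  by (simp add: inverse_pair_def)

lemma inverse_pair_mult:
  assumes "inverse_pair a b" "inverse_pair c d"
  shows "inverse_pair (a * c) (d * b)"
proof -
  have "(a * c) * (d * b) = a * (c * d) * b" "(d * b) * (a * c) = d * (b * a) * c"
    by (simp_all add: mult.assoc)
  with assms show ?thesis by (simp add: inverse_pair_def)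
qed

lemma inverse_pair_scaleC:
  assumes "inverse_pair a b" "c \<noteq> 0"
  shows "inverse_pair (c *\<^sub>C a) ((1 / c) *\<^sub>C b)"
  using assms by (simp add: inverse_pair_def scaleC_times_left scaleC_times_right scaleC_scaleC)

lemma power_scaleC: "(c *\<^sub>C h) ^ n = (c ^ n) *\<^sub>C ((h::'b::unital_banach_algebra) ^ n)"
  by (induction n) (simp_all add: scaleC_times_left scaleC_times_right scaleC_scaleC mult_ac)

lemma norm_times_le: "norm (a::'b::unital_banach_algebra) \<le> s \<Longrightarrow> norm b \<le> t \<Longrightarrow> norm (a * b) \<le> s * t"
  by (meson norm_mult_ineq norm_ge_zero mult_mono order_trans)

text \<open>The Neumann series, obtained as the fixed points of \<open>y \<mapsto> 1 + x y\<close> and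
  \<open>y \<mapsto> 1 + y x\<close>, which are contractions.\<close>

lemma inverse_pair_one_minus:
  assumes "norm (x::'b::unital_banach_algebra) < 1"
  shows "\<exists>d. inverse_pair (1 - x) d"
proof -
  have "\<exists>!y. 1 + x * y = y"
  proof (rule banach_fix_type[where c = "norm x"], goal_cases)
    case 3
    show ?case
    proof (intro allI)
      show "dist (1 + x * y) (1 + x * z) \<le> norm x * dist y z" for y z
        using norm_mult_ineq[of x "y - z"] by (simp add: dist_norm right_diff_distrib)
    qed
  qed (use assms in auto)
  then obtain y where y: "1 + x * y = y" by blast
  have "\<exists>!y. 1 + y * x = y"
  proof (rule banach_fix_type[where c = "norm x"], goal_cases)
    case 3
    show ?case
    proof (intro allI)
      show "dist (1 + y * x) (1 + z * x) \<le> norm x * dist y z" for y z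
        using norm_mult_ineq[of "y - z" x] by (simp add: dist_norm left_diff_distrib mult.commute)
    qed
  qed (use assms in auto)
  then obtain z where z: "1 + z * x = z" by blast
  have 1: "(1 - x) * y = 1" using y by (simp add: algebra_simps)
  have 2: "z * (1 - x) = 1" using z by (simp add: algebra_simps)
  have "z = z * ((1 - x) * y)" by (simp add: 1)
  also have "\<dots> = y" by (metis 2 mult.assoc mult_1_left)
  finally show ?thesis using 1 2 unfolding inverse_pair_def by blast
qed

text \<open>Factor \<open>c = a (1 + b (c - a))\<close>, where \<open>b\<close> is the inverse of \<open>a\<close>. The estimate serves
  twice: it makes inversion continuous, and it continues resolvents along a line.\<close>

lemma inverse_pair_perturbation:
  fixes a b c :: "'b::unital_banach_algebra"
  assumes ab: "inverse_pair a b" and small: "norm b * norm (c - a) \<le> 1/2"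
  shows "\<exists>d. inverse_pair c d \<and> norm (d - b) \<le> 2 * (norm b)\<^sup>2 * norm (c - a)"
proof -
  define e where "e = c - a"
  have "norm (- (b * e)) < 1"
    using norm_mult_ineq[of b e] small by (simp add: e_def)
  then obtain g where "inverse_pair (1 - (- (b * e))) g"
    using inverse_pair_one_minus by blast
  from inverse_pair_mult[OF ab this]
  have "inverse_pair (a * (1 + b * e)) (g * b)" by simp
  moreover have "a * (1 + b * e) = c"
    using ab by (simp add: inverse_pair_def e_def distrib_left flip: mult.assoc)
  ultimately obtain d where d: "inverse_pair c d" by metis
  have "b * (c * d) = d + b * e * d"
    using ab by (simp add: inverse_pair_def e_def algebra_simps flip: mult.assoc)
  hence db: "d - b = - (b * e * d)"
    using d by (simp add: inverse_pair_def algebra_simps)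
  have 1: "norm (b * e * d) \<le> (norm b * norm e) * norm d"
    by (intro norm_times_le order_refl)
  also have "\<dots> \<le> 1/2 * norm d"
    using small by (intro mult_right_mono) (auto simp: e_def)
  finally have "norm (d - b) \<le> 1/2 * norm d" by (simp add: db)
  hence "norm d \<le> 2 * norm b" using norm_triangle_ineq2[of d b] by simp
  hence "norm b * norm e * norm d \<le> norm b * norm e * (2 * norm b)"
    by (intro mult_left_mono) auto
  with 1 have "norm (d - b) \<le> 2 * (norm b)\<^sup>2 * norm e"
    by (simp add: db power2_eq_square mult_ac)
  with d show ?thesis unfolding e_def by blast
qed

lemma alg_spectrum_bound:
  assumes "z \<in> alg_spectrum (a::'b::unital_banach_algebra)"
  shows "cmod z \<le> norm a"
proof (rule ccontr)
  assume *: "\<not> ?thesis"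
  hence z: "z \<noteq> 0" using norm_ge_zero[of a] by (metis norm_zero)
  have "norm ((1/z) *\<^sub>C a) < 1"
    using * z by (simp add: norm_scaleC norm_divide divide_simps)
  then obtain d where "inverse_pair (1 - (1/z) *\<^sub>C a) d"
    using inverse_pair_one_minus by blast
  from inverse_pair_scaleC[OF this, of "-z"] z
  have "inverse_pair (a - z *\<^sub>C 1) ((1 / - z) *\<^sub>C d)"
    by (simp add: scaleC_diff_right scaleC_scaleC)
  thus False using assms unfolding alg_spectrum_def by blast
qed

lemma alg_spectrum_shift: "z + w \<in> alg_spectrum (a + w *\<^sub>C 1) \<longleftrightarrow> z \<in> alg_spectrum a"
  by (simp add: alg_spectrum_def scaleC_add_left)

lemma alg_spectrum_reflect:
  "z \<in> alg_spectrum (t *\<^sub>R 1 - a) \<longleftrightarrow> complex_of_real t - z \<in> alg_spectrum (a::'b::unital_banach_algebra)"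
proof -
  have *: "t *\<^sub>R 1 - a - z *\<^sub>C 1 = - (a - (complex_of_real t - z) *\<^sub>C (1::'b))"
    by (simp add: scaleC_diff_left scaleC_of_real)
  have "(\<exists>b. inverse_pair (- x) b) \<longleftrightarrow> (\<exists>b. inverse_pair x b)" for x :: 'b
    by (metis inverse_pair_def minus_mult_minus minus_minus)
  thus ?thesis unfolding alg_spectrum_def mem_Collect_eq * by blast
qed

text \<open>The classical formula of Jacobson, found by expanding both inverses as geometric series.\<close>

lemma inverse_pair_one_minus_swap:
  fixes a b :: "'b::unital_banach_algebra"
  assumes "inverse_pair (1 - b * a) c"
  shows "inverse_pair (1 - a * b) (1 + a * c * b)"
proof -
  have c: "c - b * a * c = 1" "c - c * b * a = 1"
    using assms by (simp_all add: inverse_pair_def algebra_simps)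
  have "(1 - a * b) * (1 + a * c * b) = 1 - a * b + a * (c - b * a * c) * b"
    by (simp add: algebra_simps)
  moreover have "(1 + a * c * b) * (1 - a * b) = 1 - a * b + a * (c - c * b * a) * b"
    by (simp add: algebra_simps)
  ultimately show ?thesis using c by (simp add: inverse_pair_def)
qed

section \<open>The spectral radius\<close>

text \<open>The partial fractions \<open>1 / (1 - x\<^sup>2) = (1 / (1 - x) + 1 / (1 + x)) / 2\<close>.\<close>

lemma half_sum_inverse_pair:
  fixes x :: "'b::unital_banach_algebra"
  assumes "inverse_pair (1 - x) f" "inverse_pair (1 + x) g"
  shows "inverse_pair (1 - x * x) ((1/2) *\<^sub>R (f + g))"
proof -
  have c: "1 - x * x = (1 + x) * (1 - x)" "1 - x * x = (1 - x) * (1 + x)"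
    by (simp_all add: algebra_simps)
  have 1: "(1 - x * x) * f = 1 + x" "f * (1 - x * x) = 1 + x"
    "(1 - x * x) * g = 1 - x" "g * (1 - x * x) = 1 - x"
    using assms unfolding inverse_pair_def
    by (metis c mult.assoc mult_1_right, metis c mult.assoc mult_1_left,
        metis c mult.assoc mult_1_right, metis c mult.assoc mult_1_left)
  have "(1 + x) + (1 - x) = (2::real) *\<^sub>R (1::'b)"
    by (simp add: scaleR_2)
  thus ?thesis
    unfolding inverse_pair_def by (simp add: 1 distrib_left distrib_right del: scaleR_right_distrib add_diff_eq)
qed

text \<open>Inversion is continuous and a circle is compact.\<close>

lemma inverses_bounded_on_circle:
  fixes h :: "'b::unital_banach_algebra"
  assumes "\<And>w. cmod w = q \<Longrightarrow> \<exists>f. inverse_pair (1 - w *\<^sub>C h) f"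
  obtains M where "M \<ge> 1"
    "\<And>w. cmod w = q \<Longrightarrow> \<exists>f. inverse_pair (1 - w *\<^sub>C h) f \<and> norm f \<le> M"
proof -
  obtain g where g: "\<And>w. cmod w = q \<Longrightarrow> inverse_pair (1 - w *\<^sub>C h) (g w)"
    using assms by metis
  have g_unique: "f = g w" if "inverse_pair (1 - w *\<^sub>C h) f" "cmod w = q" for f w
    using that g[of w] unfolding inverse_pair_def by (metis mult.assoc mult_1_left mult_1_right)
  have "continuous_on (sphere 0 q) g"
    unfolding continuous_on_iff
  proof (intro ballI allI impI)
    fix w :: complex and e :: real assume w: "w \<in> sphere 0 q" and e: "e > 0"
    define k where "k = norm (g w)"
    define \<delta> where "\<delta> = min (1 / (2 * (k * norm h + 1))) (e / (2 * k\<^sup>2 * norm h + 1))"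
    have k: "k \<ge> 0" by (simp add: k_def)
    have pos: "0 < 2 * (k * norm h + 1)" "0 < 2 * k\<^sup>2 * norm h + 1"
      using k by (simp_all add: add_nonneg_pos)
    have \<delta>: "\<delta> > 0" using pos e by (simp add: \<delta>_def)
    have "dist (g v) (g w) < e" if v: "v \<in> sphere 0 q" "dist v w < \<delta>" for v
    proof -
      define m where "m = cmod (v - w)"
      have m: "0 \<le> m" "m < 1 / (2 * (k * norm h + 1))" "m < e / (2 * k\<^sup>2 * norm h + 1)"
        using v by (auto simp: m_def \<delta>_def dist_norm)
      have diff: "norm ((1 - v *\<^sub>C h) - (1 - w *\<^sub>C h)) = m * norm h"
      proof -
        have "(1 - v *\<^sub>C h) - (1 - w *\<^sub>C h) = (w - v) *\<^sub>C h" by (simp add: scaleC_diff_left)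
        thus ?thesis by (simp add: norm_scaleC m_def norm_minus_commute)
      qed
      have m1: "m * (2 * (k * norm h + 1)) < 1" "m * (2 * k\<^sup>2 * norm h + 1) < e"
        using m(2,3) pos by (simp_all add: pos_less_divide_eq)
      have "k * (m * norm h) \<le> 1/2"
        using m1(1) m(1) by (simp add: algebra_simps)
      then obtain d where d: "inverse_pair (1 - v *\<^sub>C h) d"
        "norm (d - g w) \<le> 2 * k\<^sup>2 * (m * norm h)"
        using inverse_pair_perturbation[OF g, of w "1 - v *\<^sub>C h"] w diff by (auto simp: k_def)
      have "d = g v" using g_unique d(1) v(1) by simp
      moreover have "2 * k\<^sup>2 * (m * norm h) < e"
        using m1(2) m(1) by (simp add: algebra_simps)
      ultimately show ?thesis using d(2) by (simp add: dist_norm)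
    qed
    thus "\<exists>d>0. \<forall>x'\<in>sphere 0 q. dist x' w < d \<longrightarrow> dist (g x') (g w) < e"
      using \<delta> by blast
  qed
  hence "bounded (g ` sphere 0 q)"
    by (intro compact_imp_bounded compact_continuous_image compact_sphere)
  then obtain B where "\<forall>y\<in>g ` sphere 0 q. norm y \<le> B"
    unfolding bounded_iff by blast
  hence "\<And>w. cmod w = q \<Longrightarrow> norm (g w) \<le> B" by simp
  hence "\<And>w. cmod w = q \<Longrightarrow> norm (g w) \<le> max B 1" by (simp add: le_max_iff_disj)
  thus thesis using that[of "max B 1"] g by (metis max.cobounded2)
qed

text \<open>An argument of Rickart, which replaces the holomorphic calculus by averages over roots of
  unity. If no point of the circle \<open>|z| = r\<close> belongs to the spectrum, then for \<open>w\<close> on two circles slightly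
  inside and slightly outside \<open>|w| = 1 / r\<close> the inverses of \<open>1 - w h\<close> are uniformly close. By
  partial fractions, averages of these inverses are inverses of \<open>1 - (w h)\<^bsup>n\<^esup>\<close> with \<open>n = 2\<^bsup>k\<^esup>\<close>, and averaging
  keeps them as close as before. On the inner circle \<open>(w h)\<^bsup>n\<^esup>\<close> tends to zero and the inverse to the
  unit; on the outer circle \<open>(w h)\<^bsup>n\<^esup>\<close> is unbounded, so the inverse cannot stay near the unit.\<close>

lemma spectral_radius_attained:
  fixes h :: "'b::unital_banach_algebra"
  assumes r: "r > 0" and pow: "\<And>k. norm (h ^ (2 ^ k)) = r ^ (2 ^ k)"
  shows "\<exists>z. cmod z = r \<and> z \<in> alg_spectrum h"
proof (rule ccontr)
  assume no: "\<not> ?thesis"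
  have nh: "norm h = r" using pow[of 0] by simp
  have "\<exists>f. inverse_pair (1 - w *\<^sub>C h) f" if w: "cmod w = 1 / r" for w
  proof -
    have w0: "w \<noteq> 0" using w r by auto
    have "cmod (1 / w) = r" using w r by (simp add: norm_divide)
    with no obtain b where "inverse_pair (h - (1 / w) *\<^sub>C 1) b" unfolding alg_spectrum_def by blast
    from inverse_pair_scaleC[OF this, of "- w"] w0
    show ?thesis by (auto simp: scaleC_diff_right scaleC_scaleC)
  qed
  then obtain M where M: "M \<ge> 1"
    "\<And>w. cmod w = 1 / r \<Longrightarrow> \<exists>f. inverse_pair (1 - w *\<^sub>C h) f \<and> norm f \<le> M"
    using inverses_bounded_on_circle by metis
  \<comment> \<open>The radii \<open>(1 \<plusminus> \<eta>) / r\<close>: close enough for each inverse to lie within \<open>1/8\<close> of the one at radius \<open>1 / r\<close>.\<close>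
  define \<eta> where "\<eta> = 1 / (16 * M\<^sup>2)"
  have M2: "M\<^sup>2 \<ge> 1" using M(1) by simp
  have \<eta>: "0 < \<eta>" "\<eta> < 1" "M * \<eta> \<le> 1/2" "2 * M\<^sup>2 * \<eta> = 1/8"
    using M(1) M2 by (simp_all add: \<eta>_def field_simps power2_eq_square)

  define a where "a s w k = 1 - ((complex_of_real s * w) *\<^sub>C h) ^ (2 ^ k)" for s w k
  have base: "\<exists>F. inverse_pair (a s w 0) F \<and> norm (F - f) \<le> 1/8"
    if s: "\<bar>s - 1\<bar> = \<eta>" and w: "cmod w = 1 / r" and f: "inverse_pair (1 - w *\<^sub>C h) f" "norm f \<le> M"
    for s w f
  proof -
    have "a s w 0 - (1 - w *\<^sub>C h) = (w - complex_of_real s * w) *\<^sub>C h"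
      by (simp add: a_def scaleC_diff_left)
    also have "w - complex_of_real s * w = complex_of_real (1 - s) * w"
      by (simp add: algebra_simps)
    finally have e: "norm (a s w 0 - (1 - w *\<^sub>C h)) = \<eta>"
      using s w r nh by (simp add: norm_scaleC norm_mult abs_minus_commute del: of_real_diff)
    have "norm f * \<eta> \<le> 1/2" using f(2) \<eta> by (meson mult_right_mono order_trans less_imp_le)
    then obtain F where F: "inverse_pair (a s w 0) F" "norm (F - f) \<le> 2 * (norm f)\<^sup>2 * \<eta>"
      using inverse_pair_perturbation[OF f(1), of "a s w 0"] e by auto
    have "2 * (norm f)\<^sup>2 * \<eta> \<le> 2 * M\<^sup>2 * \<eta>"
      using f(2) \<eta> by (intro mult_right_mono mult_left_mono power_mono) auto
    with F(2) \<eta>(4) have "norm (F - f) \<le> 1/8" by linarith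
    with F(1) show ?thesis by blast
  qed
  have P: "\<exists>F G. inverse_pair (a (1 - \<eta>) w k) F \<and> inverse_pair (a (1 + \<eta>) w k) G \<and> norm (F - G) \<le> 1/4"
    if "cmod w = 1 / r" for w k
    using that
  proof (induction k arbitrary: w)
    case 0
    obtain f where f: "inverse_pair (1 - w *\<^sub>C h) f" "norm f \<le> M" using M(2)[OF 0] by blast
    obtain F where F: "inverse_pair (a (1 - \<eta>) w 0) F" "norm (F - f) \<le> 1/8"
      using base[of "1 - \<eta>", OF _ 0 f] \<eta> by auto
    obtain G where G: "inverse_pair (a (1 + \<eta>) w 0) G" "norm (G - f) \<le> 1/8"
      using base[of "1 + \<eta>", OF _ 0 f] \<eta> by auto
    have "norm (F - G) \<le> norm (F - f) + norm (G - f)"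
      using norm_triangle_ineq4[of "F - f" "G - f"] by simp
    with F G show ?case by (intro exI[of _ F] exI[of _ G]) auto
  next
    case (Suc k)
    \<comment> \<open>A root of unity that turns \<open>x = (w h)\<^bsup>n\<^esup>\<close> into \<open>- x\<close>.\<close>
    define u where "u = cis (pi / 2 ^ k)"
    have u: "u ^ (2 ^ k) = -1" unfolding u_def Complex.DeMoivre by simp
    have "cmod (u * w) = 1 / r" using Suc.prems by (simp add: u_def norm_mult)
    from Suc.IH[OF this] obtain F' G' where
      1: "inverse_pair (a (1 - \<eta>) (u * w) k) F'" "inverse_pair (a (1 + \<eta>) (u * w) k) G'"
         "norm (F' - G') \<le> 1/4" by blast
    from Suc.IH[OF Suc.prems] obtain F G where
      2: "inverse_pair (a (1 - \<eta>) w k) F" "inverse_pair (a (1 + \<eta>) w k) G" "norm (F - G) \<le> 1/4"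
      by blast
    have step: "inverse_pair (a s w (Suc k)) ((1/2) *\<^sub>R (f + g))"
      if "inverse_pair (a s w k) f" "inverse_pair (a s (u * w) k) g" for s f g
    proof -
      define x where "x = ((complex_of_real s * w) *\<^sub>C h) ^ (2 ^ k)"
      have "((complex_of_real s * (u * w)) *\<^sub>C h) ^ (2 ^ k) = (u ^ (2 ^ k)) *\<^sub>C x"
        by (simp add: x_def power_scaleC scaleC_scaleC power_mult_distrib mult_ac)
      hence "a s (u * w) k = 1 + x" by (simp add: a_def u)
      moreover have "a s w k = 1 - x" by (simp add: a_def x_def)
      moreover have "a s w (Suc k) = 1 - x * x"
        by (simp add: a_def x_def mult_2 flip: power_add)
      ultimately show ?thesis using that half_sum_inverse_pair by metis
    qed
    have "(1/2) *\<^sub>R (F + F') - (1/2) *\<^sub>R (G + G') = (1/2::real) *\<^sub>R ((F - G) + (F' - G'))"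
      by (simp add: scaleR_add_right scaleR_diff_right)
    hence "norm ((1/2) *\<^sub>R (F + F') - (1/2) *\<^sub>R (G + G')) = 1/2 * norm ((F - G) + (F' - G'))"
      by simp
    also have "\<dots> \<le> 1/2 * (1/4 + 1/4)"
      using norm_triangle_mono[OF 2(3) 1(3)] by simp
    finally have "norm ((1/2) *\<^sub>R (F + F') - (1/2) *\<^sub>R (G + G')) \<le> 1/4" by simp
    with step[OF 2(1) 1(1)] step[OF 2(2) 1(2)] show ?case by blast
  qed
  obtain n1 where n1: "(1 - \<eta>) ^ n1 < 1/8" using real_arch_pow_inv[of "1/8" "1 - \<eta>"] \<eta> by auto
  obtain n2 where n2: "3 < (1 + \<eta>) ^ n2" using real_arch_pow[of "1 + \<eta>" 3] \<eta> by auto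
  define k where "k = max n1 n2"
  have k: "n1 \<le> 2 ^ k" "n2 \<le> 2 ^ k" using less_exp[of k] unfolding k_def by linarith+
  have n: "(1 - \<eta>) ^ (2 ^ k) < 1/8" "3 < (1 + \<eta>) ^ (2 ^ k)"
    using power_decreasing[OF k(1), of "1 - \<eta>"] power_increasing[OF k(2), of "1 + \<eta>"] n1 n2 \<eta>
    by linarith+
  define w where "w = complex_of_real (1 / r)"
  have w: "cmod w = 1 / r" using r by (simp add: w_def norm_divide)
  define x where "x = ((complex_of_real (1 - \<eta>) * w) *\<^sub>C h) ^ (2 ^ k)"
  define y where "y = ((complex_of_real (1 + \<eta>) * w) *\<^sub>C h) ^ (2 ^ k)"
  have nrm: "norm (((complex_of_real s * w) *\<^sub>C h) ^ (2 ^ k)) = s ^ (2 ^ k)" if "s \<ge> 0" for s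
    using that r w by (simp add: power_scaleC norm_scaleC norm_power norm_mult pow
        flip: power_mult_distrib)
  have x: "norm x < 1/8" and y: "norm y > 3"
    using n nrm[of "1 - \<eta>"] nrm[of "1 + \<eta>"] \<eta> by (simp_all add: x_def y_def)
  obtain F G where FG: "inverse_pair (1 - x) F" "inverse_pair (1 - y) G" "norm (F - G) \<le> 1/4"
    using P[OF w, of k] unfolding a_def x_def y_def by blast
  \<comment> \<open>The inner inverse is near the unit, hence so is the outer one, which bounds \<open>y\<close>.\<close>
  have F1: "F - 1 = x * F" using FG(1) by (simp add: inverse_pair_def algebra_simps)
  have xF: "norm (x * F) \<le> 1/8 * norm F" using x by (intro norm_times_le) auto
  have "norm F \<le> norm (1::'b) + norm (F - 1)"
    using norm_triangle_ineq[of 1 "F - 1"] by simp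
  hence "norm F \<le> 1 + 1/8 * norm F" using xF norm_one_le[where 'a = 'b] unfolding F1 by linarith
  with F1 xF have "norm (F - 1) \<le> 1/7" by simp
  with FG(3) have G1: "norm (1 - G) \<le> 1/2"
    using norm_triangle_ineq4[of "F - G" "F - 1"] by (simp add: norm_minus_commute)
  have Gy: "1 - y = 1 + (1 - y) * (1 - G)" using FG(2) by (simp add: inverse_pair_def algebra_simps)
  have "norm ((1 - y) * (1 - G)) \<le> norm (1 - y) * (1/2)" using G1 by (intro norm_times_le) auto
  hence "norm (1 - y) \<le> 1 + norm (1 - y) * (1/2)"
    using norm_triangle_ineq[of 1 "(1 - y) * (1 - G)", folded Gy] norm_one_le[where 'a = 'b]
    by linarith
  hence "norm (1 - y) \<le> 2" by simp
  hence "norm y \<le> 3"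
    using norm_triangle_ineq4[of 1 "1 - y"] norm_one_le[where 'a = 'b] by simp
  with y show False by simp
qed

section \<open>Spectrum and order of self-adjoint elements\<close>

text \<open>What is left of the C*-identity when the algebra around \<open>S\<close> carries no involution: for
  self-adjoint \<open>h\<close> and real \<open>t\<close> one has \<open>(h + i t)* (h + i t) = h\<^sup>2 + t\<^sup>2\<close>. All bounded operators on a Banach space
  form such an algebra. With \<open>t = 0\<close> the inequality gives \<open>\<parallel>h\<^sup>2\<parallel> = \<parallel>h\<parallel>\<^sup>2\<close>, and with large \<open>|t|\<close> it forces the
  spectrum to be real.\<close>

locale symmetric_family =
  fixes S :: "'b::unital_banach_algebra set"
  assumes one_mem: "1 \<in> S"
    and add_mem: "h \<in> S \<Longrightarrow> k \<in> S \<Longrightarrow> h + k \<in> S"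
    and scaleR_mem: "h \<in> S \<Longrightarrow> t *\<^sub>R h \<in> S"
    and square_mem: "h \<in> S \<Longrightarrow> h * h \<in> S"
    and shifted_norm: "h \<in> S \<Longrightarrow>
      (norm (h + (\<i> * complex_of_real t) *\<^sub>C 1))\<^sup>2 \<le> norm (h * h + t\<^sup>2 *\<^sub>R 1)"
begin

lemma diff_mem: "h \<in> S \<Longrightarrow> k \<in> S \<Longrightarrow> h - k \<in> S"
  using add_mem[of h "(-1) *\<^sub>R k"] scaleR_mem[of k "-1"] by simp

lemma norm_square: 
  assumes "h \<in> S"
  shows "norm (h * h) = (norm h)\<^sup>2"
proof (rule antisym)
  show "norm (h * h) \<le> (norm h)\<^sup>2" unfolding power2_eq_square by (rule norm_mult_ineq)
  show "(norm h)\<^sup>2 \<le> norm (h * h)" using shifted_norm[OF assms, of 0] by simp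
qed

lemma norm_power_two_power: "h \<in> S \<Longrightarrow> h ^ (2 ^ k) \<in> S \<and> norm (h ^ (2 ^ k)) = norm h ^ (2 ^ k)"
proof (induction k)
  case (Suc k)
  have "h ^ (2 ^ Suc k) = h ^ (2 ^ k) * h ^ (2 ^ k)"
    "norm h ^ (2 ^ Suc k) = (norm h ^ (2 ^ k))\<^sup>2"
    by (simp_all add: mult_2 power2_eq_square flip: power_add)
  with Suc show ?case by (simp add: square_mem norm_square)
qed auto

text \<open>The trick of Arens: \<open>z + i t\<close> is in the spectrum of \<open>h + i t\<close>, so
  \<open>(Im z + t)\<^sup>2 \<le> \<parallel>h\<parallel>\<^sup>2 + t\<^sup>2\<close> for every real \<open>t\<close>, of either sign.\<close>

lemma spectrum_real:
  assumes h: "h \<in> S" and z: "z \<in> alg_spectrum h"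
  shows "z = complex_of_real (Re z)"
proof -
  have bound: "2 * t * Im z \<le> (norm h)\<^sup>2" for t
  proof -
    have "z + \<i> * complex_of_real t \<in> alg_spectrum (h + (\<i> * complex_of_real t) *\<^sub>C 1)"
      using z by (simp only: alg_spectrum_shift)
    hence "(cmod (z + \<i> * complex_of_real t))\<^sup>2 \<le> (norm (h + (\<i> * complex_of_real t) *\<^sub>C 1))\<^sup>2"
      by (intro power_mono alg_spectrum_bound) auto
    also have "\<dots> \<le> norm (h * h + t\<^sup>2 *\<^sub>R 1)" using h by (rule shifted_norm)
    also have "\<dots> \<le> (norm h)\<^sup>2 + t\<^sup>2"
    proof (rule norm_triangle_mono)
      show "norm (h * h) \<le> (norm h)\<^sup>2" using h by (simp add: norm_square)
      show "norm (t\<^sup>2 *\<^sub>R (1::'b)) \<le> t\<^sup>2"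
        using mult_left_mono[OF norm_one_le[where 'a='b], of "t\<^sup>2"] by simp
    qed
    finally have "(Re z)\<^sup>2 + (Im z + t)\<^sup>2 \<le> (norm h)\<^sup>2 + t\<^sup>2" by (simp add: cmod_power2)
    moreover have "(Im z + t)\<^sup>2 = (Im z)\<^sup>2 + 2 * t * Im z + t\<^sup>2"
      by (simp add: power2_eq_square algebra_simps)
    moreover have "(Re z)\<^sup>2 \<ge> 0" "(Im z)\<^sup>2 \<ge> 0" by simp_all
    ultimately show ?thesis by linarith
  qed
  have "Im z = 0"
  proof (rule ccontr)
    assume "Im z \<noteq> 0"
    with bound[of "((norm h)\<^sup>2 + 1) / (2 * Im z)"] show False by simp
  qed
  thus ?thesis by (simp add: complex_eq_iff)
qed

lemma norm_in_spectrum: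
  assumes "h \<in> S" "h \<noteq> 0"
  obtains t where "complex_of_real t \<in> alg_spectrum h" "\<bar>t\<bar> = norm h"
proof -
  obtain z where z: "cmod z = norm h" "z \<in> alg_spectrum h"
    using spectral_radius_attained[of "norm h" h] norm_power_two_power[OF assms(1)] assms(2) by auto
  with spectrum_real[OF assms(1) z(2)] show thesis
    using that[of "Re z"] by (metis norm_of_real)
qed

definition pos :: "'b \<Rightarrow> bool" where
  "pos h \<longleftrightarrow> h \<in> S \<and> alg_spectrum h \<subseteq> complex_of_real ` {0..}"

lemma pos_mem: "pos h \<Longrightarrow> h \<in> S"
  by (simp add: pos_def)

lemma pos_spectrum: "pos h \<Longrightarrow> complex_of_real t \<in> alg_spectrum h \<Longrightarrow> 0 \<le> t"
  unfolding pos_def by (auto dest!: subsetD)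

lemma posI:
  assumes "h \<in> S" "\<And>t. complex_of_real t \<in> alg_spectrum h \<Longrightarrow> 0 \<le> t"
  shows "pos h"
  unfolding pos_def
proof (intro conjI subsetI)
  fix z assume z: "z \<in> alg_spectrum h"
  with spectrum_real[OF assms(1) z] assms(2)[of "Re z"] show "z \<in> complex_of_real ` {0..}"
    by (metis atLeast_iff image_eqI)
qed (rule assms(1))

lemma reflect_mem: "h \<in> S \<Longrightarrow> t *\<^sub>R 1 - h \<in> S"
  by (intro diff_mem scaleR_mem one_mem)

text \<open>This lemma and the next one trade the spectral condition for the inequality
  \<open>\<parallel>t - h\<parallel> \<le> t\<close>, which, unlike a spectrum, can be added up.\<close>

lemma norm_reflect_le_imp_pos:
  assumes h: "h \<in> S" and le: "norm (t *\<^sub>R 1 - h) \<le> t"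
  shows "pos h"
proof (rule posI[OF h])
  fix s assume "complex_of_real s \<in> alg_spectrum h"
  hence "complex_of_real (t - s) \<in> alg_spectrum (t *\<^sub>R 1 - h)" by (simp add: alg_spectrum_reflect)
  from alg_spectrum_bound[OF this] le show "0 \<le> s" by (simp del: of_real_diff)
qed

lemma pos_imp_norm_reflect_le:
  assumes h: "pos h" and le: "norm h \<le> t"
  shows "norm (t *\<^sub>R 1 - h) \<le> t"
proof (cases "t *\<^sub>R 1 - h = 0")
  case True
  thus ?thesis using order_trans[OF norm_ge_zero le] by simp
next
  case False
  then obtain s where s: "complex_of_real s \<in> alg_spectrum (t *\<^sub>R 1 - h)"
    "\<bar>s\<bar> = norm (t *\<^sub>R 1 - h)"
    using norm_in_spectrum[OF reflect_mem] pos_mem[OF h] by metis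
  have ts: "complex_of_real (t - s) \<in> alg_spectrum h" using s(1) by (simp add: alg_spectrum_reflect)
  hence "0 \<le> t - s" using pos_spectrum h by blast
  moreover have "t - s \<le> t" using alg_spectrum_bound[OF ts] le by (simp del: of_real_diff)
  ultimately show ?thesis using s(2) by linarith
qed

lemma pos_add:
  assumes "pos h" "pos k"
  shows "pos (h + k)"
proof (rule norm_reflect_le_imp_pos)
  show "h + k \<in> S" using assms by (simp add: pos_mem add_mem)
  have "(norm h + norm k) *\<^sub>R 1 - (h + k) = (norm h *\<^sub>R 1 - h) + (norm k *\<^sub>R 1 - k)"
    by (simp add: scaleR_add_left)
  thus "norm ((norm h + norm k) *\<^sub>R 1 - (h + k)) \<le> norm h + norm k"
    using norm_triangle_mono[OF pos_imp_norm_reflect_le[OF assms(1) order_refl]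
        pos_imp_norm_reflect_le[OF assms(2) order_refl]] by metis
qed

lemma pos_reflect:
  assumes "h \<in> S" "norm h \<le> t"
  shows "pos (t *\<^sub>R 1 - h)"
  using assms by (intro norm_reflect_le_imp_pos[of _ t] reflect_mem) auto

lemma norm_le_if_pos_reflect:
  assumes h: "h \<in> S" and 1: "pos (t *\<^sub>R 1 - h)" and 2: "pos (t *\<^sub>R 1 + h)" and t: "0 \<le> t"
  shows "norm h \<le> t"
proof (cases "h = 0")
  case False
  then obtain s where s: "complex_of_real s \<in> alg_spectrum h" "\<bar>s\<bar> = norm h"
    using norm_in_spectrum[OF h] by metis
  have "complex_of_real (t - s) \<in> alg_spectrum (t *\<^sub>R 1 - h)"
    using s(1) by (simp add: alg_spectrum_reflect)
  hence "s \<le> t" using pos_spectrum[OF 1] by fastforce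
  moreover have "complex_of_real (t + s) \<in> alg_spectrum (t *\<^sub>R 1 + h)"
    using s(1) alg_spectrum_shift[of "complex_of_real s" "complex_of_real t" h]
    by (simp add: scaleC_of_real add.commute)
  hence "0 \<le> t + s" using pos_spectrum[OF 2] by blast
  ultimately show ?thesis using s(2) by linarith
qed (simp add: t)

text \<open>With \<open>m = \<parallel>h + k\<parallel>\<close>, the element \<open>m - h = (m - (h + k)) + k\<close> is a sum of two positive ones.\<close>

lemma norm_le_norm_add:
  assumes h: "pos h" and k: "pos k"
  shows "norm h \<le> norm (h + k)"
proof (rule norm_le_if_pos_reflect)
  have "pos (norm (h + k) *\<^sub>R 1 - (h + k) + k)"
    by (intro pos_add k pos_reflect) (simp_all add: add_mem pos_mem h k)
  thus "pos (norm (h + k) *\<^sub>R 1 - h)" by simp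
  have "pos (norm (h + k) *\<^sub>R 1 - 0)"
    using scaleR_mem[OF one_mem, of 0] by (intro pos_reflect) auto
  with h show "pos (norm (h + k) *\<^sub>R 1 + h)" using pos_add by fastforce
qed (simp_all add: pos_mem h)

text \<open>With \<open>m\<close> the larger norm, both \<open>(m - h) + k\<close> and \<open>(m - k) + h\<close> are positive.\<close>

lemma norm_diff_le_max:
  assumes h: "pos h" and k: "pos k"
  shows "norm (h - k) \<le> max (norm h) (norm k)"
proof (rule norm_le_if_pos_reflect)
  let ?m = "max (norm h) (norm k)"
  have "pos (?m *\<^sub>R 1 - h + k)" by (intro pos_add k pos_reflect) (simp_all add: pos_mem h)
  thus "pos (?m *\<^sub>R 1 - (h - k))" by (simp add: algebra_simps)
  have "pos (?m *\<^sub>R 1 - k + h)" by (intro pos_add h pos_reflect) (simp_all add: pos_mem k)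
  thus "pos (?m *\<^sub>R 1 + (h - k))" by (simp add: algebra_simps)
qed (simp_all add: pos_mem h k diff_mem le_max_iff_disj)

end

section \<open>Square roots\<close>

text \<open>A fixed point \<open>y\<close> satisfies \<open>y = (b + y\<^sup>2) / 2\<close>, that is, \<open>(1 - y)\<^sup>2 = 1 - b\<close>. For the real number
  \<open>b = 1\<close> the iteration increases and never exceeds \<open>1\<close>; it dominates, step by step, the iteration
  for any \<open>b\<close> of norm at most \<open>1\<close>, and so proves its convergence.\<close>

primrec sqrt_iteration :: "'b::real_algebra \<Rightarrow> nat \<Rightarrow> 'b" where
  "sqrt_iteration b 0 = 0"
| "sqrt_iteration b (Suc n) = (1/2) *\<^sub>R (b + sqrt_iteration b n * sqrt_iteration b n)"

lemma sqrt_iteration_real: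
  "0 \<le> sqrt_iteration (1::real) n \<and> sqrt_iteration (1::real) n \<le> 1"
proof (induction n)
  case (Suc n)
  hence "0 \<le> sqrt_iteration (1::real) n * sqrt_iteration 1 n"
    "sqrt_iteration (1::real) n * sqrt_iteration 1 n \<le> 1"
    by (auto intro: mult_le_one)
  thus ?case by simp
qed simp

lemma norm_sqrt_iteration:
  fixes b :: "'b::real_normed_algebra"
  assumes b: "norm b \<le> 1"
  shows "norm (sqrt_iteration b n) \<le> sqrt_iteration 1 n"
proof (induction n)
  case (Suc n)
  have "norm (sqrt_iteration b n * sqrt_iteration b n) \<le> sqrt_iteration 1 n * sqrt_iteration 1 n"
    using Suc by (meson norm_mult_ineq norm_ge_zero mult_mono order_trans)
  with b show ?case using norm_triangle_mono[OF b] by fastforce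
qed simp

text \<open>Compare \<open>z\<^sup>2 - y\<^sup>2 = z (z - y) + (z - y) y\<close> with \<open>v\<^sup>2 - u\<^sup>2 = v (v - u) + (v - u) u\<close>.\<close>

lemma sqrt_iteration_step:
  fixes b :: "'b::real_normed_algebra"
  assumes b: "norm b \<le> 1"
  shows "norm (sqrt_iteration b (Suc n) - sqrt_iteration b n)
    \<le> sqrt_iteration 1 (Suc n) - sqrt_iteration 1 n"
proof (induction n)
  case 0
  show ?case using b by simp
next
  case (Suc n)
  define y z where "y = sqrt_iteration b n" and "z = sqrt_iteration b (Suc n)"
  define u v :: real where "u = sqrt_iteration 1 n" and "v = sqrt_iteration 1 (Suc n)"
  have uv: "norm y \<le> u" "norm z \<le> v" "norm (z - y) \<le> v - u"
    using Suc.IH norm_sqrt_iteration[OF b] unfolding y_def z_def u_def v_def by blast+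
  have "sqrt_iteration b (Suc (Suc n)) - z = (1/2) *\<^sub>R (b + z * z) - (1/2) *\<^sub>R (b + y * y)"
    by (simp add: y_def z_def)
  also have "\<dots> = (1/2) *\<^sub>R (z * (z - y) + (z - y) * y)"
    by (simp add: algebra_simps flip: scaleR_diff_right)
  finally have "norm (sqrt_iteration b (Suc (Suc n)) - z) = 1/2 * norm (z * (z - y) + (z - y) * y)"
    by simp
  also have "\<dots> \<le> 1/2 * (v * (v - u) + (v - u) * u)"
  proof (intro mult_left_mono norm_triangle_mono)
    show "norm (z * (z - y)) \<le> v * (v - u)" "norm ((z - y) * y) \<le> (v - u) * u"
      using uv by (meson norm_mult_ineq norm_ge_zero mult_mono order_trans)+
  qed simp
  also have "\<dots> = sqrt_iteration 1 (Suc (Suc n)) - v"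
    by (simp add: u_def v_def algebra_simps)
  finally show ?case by (simp only: z_def v_def)
qed

lemma sqrt_iteration_limit:
  fixes b :: "'b::{real_normed_algebra, banach}"
  assumes b: "norm b \<le> 1"
  obtains y where "sqrt_iteration b \<longlonglongrightarrow> y" "norm y \<le> 1" "y = (1/2) *\<^sub>R (b + y * y)"
proof -
  let ?\<eta> = "sqrt_iteration (1::real)"
  have diff: "norm (sqrt_iteration b m - sqrt_iteration b n) \<le> ?\<eta> m - ?\<eta> n" if "n \<le> m" for m n
    using that
  proof (induction m rule: dec_induct)
    case (step m)
    show ?case
      using norm_triangle_mono[OF sqrt_iteration_step[OF b, of m] step.IH]
      by (simp del: sqrt_iteration.simps)
  qed simp
  have "incseq ?\<eta>"
    by (intro incseq_SucI) (use order_trans[OF norm_ge_zero sqrt_iteration_step[OF b]] in force)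
  hence "convergent ?\<eta>"
    using sqrt_iteration_real by (metis incseq_convergent convergentI)
  hence C: "Cauchy ?\<eta>" by (rule convergent_Cauchy)
  have "Cauchy (sqrt_iteration b)"
  proof (rule CauchyI')
    fix e :: real assume "e > 0"
    then obtain M where M: "\<forall>m\<ge>M. \<forall>n\<ge>M. norm (?\<eta> m - ?\<eta> n) < e" using CauchyD[OF C] by blast
    show "\<exists>M. \<forall>m\<ge>M. \<forall>n>m. dist (sqrt_iteration b m) (sqrt_iteration b n) < e"
    proof (intro exI[of _ M] allI impI)
      fix m n assume mn: "M \<le> m" "m < n"
      have "norm (sqrt_iteration b n - sqrt_iteration b m) \<le> ?\<eta> n - ?\<eta> m" using diff mn by simp
      also have "\<dots> \<le> norm (?\<eta> n - ?\<eta> m)" by simp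
      also have "\<dots> < e" using M mn by simp
      finally show "dist (sqrt_iteration b m) (sqrt_iteration b n) < e"
        by (simp add: dist_norm norm_minus_commute)
    qed
  qed
  then obtain y where y: "sqrt_iteration b \<longlonglongrightarrow> y"
    using Cauchy_convergent convergent_def by blast
  have "norm y \<le> 1"
    by (rule Lim_bounded[OF tendsto_norm[OF y], of 0])
      (use norm_sqrt_iteration[OF b] sqrt_iteration_real order_trans in blast)
  moreover have "(\<lambda>n. sqrt_iteration b (Suc n)) \<longlonglongrightarrow> (1/2) *\<^sub>R (b + y * y)"
    unfolding sqrt_iteration.simps by (intro tendsto_intros y)
  with y have "y = (1/2) *\<^sub>R (b + y * y)" using LIMSEQ_Suc LIMSEQ_unique by blast
  ultimately show thesis using that y by blast
qed

lemma sqrt_iteration_commute: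
  fixes b k :: "'b::real_algebra"
  assumes "k * b = b * k"
  shows "k * sqrt_iteration b n = sqrt_iteration b n * k"
proof (induction n)
  case (Suc n)
  have "k * (sqrt_iteration b n * sqrt_iteration b n) = sqrt_iteration b n * sqrt_iteration b n * k"
    by (metis Suc mult.assoc)
  thus ?case by (simp add: distrib_left distrib_right assms)
qed simp

locale closed_symmetric_family = symmetric_family +
  assumes closed_family: "closed S"
begin

text \<open>The commutation property holds because the iterates are polynomials in \<open>h\<close>; it is what
  makes the square root unique.\<close>

lemma pos_sqrt:
  assumes h: "pos h"
  obtains s where "pos s" "s * s = h" "\<And>k. k * h = h * k \<Longrightarrow> k * s = s * k"
proof -
  \<comment> \<open>Any positive bound of \<open>\<parallel>h\<parallel>\<close> will do; adding \<open>1\<close> covers \<open>h = 0\<close>.\<close>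
  define t where "t = norm h + 1"
  have t: "t > 0" "norm h \<le> t" by (simp_all add: t_def add_nonneg_pos)
  define b where "b = (1 / t) *\<^sub>R (t *\<^sub>R 1 - h)"
  have b_mem: "b \<in> S" unfolding b_def using h by (intro scaleR_mem reflect_mem pos_mem)
  have "norm b \<le> 1"
    using pos_imp_norm_reflect_le[OF h t(2)] t(1) by (simp add: b_def)
  then obtain y where y: "sqrt_iteration b \<longlonglongrightarrow> y" "norm y \<le> 1" "y = (1/2) *\<^sub>R (b + y * y)"
    using sqrt_iteration_limit by blast
  have "sqrt_iteration b n \<in> S" for n
  proof (induction n)
    case 0
    show ?case using scaleR_mem[OF one_mem, of 0] by simp
  next
    case (Suc n)
    thus ?case unfolding sqrt_iteration.simps by (intro scaleR_mem add_mem b_mem square_mem)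
  qed
  hence y_mem: "y \<in> S" using closed_sequentially[OF closed_family _ y(1)] by blast
  have "2 *\<^sub>R y = b + y * y" by (subst y(3)) simp
  hence "(1 - y) * (1 - y) = 1 - b"
    by (simp add: algebra_simps scaleR_2)
  also have "\<dots> = (1 / t) *\<^sub>R h" using t(1) by (simp add: b_def scaleR_diff_right)
  finally have sq: "(1 - y) * (1 - y) = (1 / t) *\<^sub>R h" .
  define s where "s = sqrt t *\<^sub>R (1 - y)"
  have "s * s = h" using t(1) by (simp add: s_def sq)
  moreover have "pos s"
  proof (rule norm_reflect_le_imp_pos[where t = "sqrt t"])
    show "s \<in> S" unfolding s_def by (intro scaleR_mem diff_mem one_mem y_mem)
    have "sqrt t *\<^sub>R 1 - s = sqrt t *\<^sub>R y" by (simp add: s_def scaleR_diff_right)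
    thus "norm (sqrt t *\<^sub>R 1 - s) \<le> sqrt t"
      using y(2) t(1) by (simp add: mult_left_le)
  qed
  moreover have "k * s = s * k" if "k * h = h * k" for k
  proof -
    have "k * b = b * k" using that by (simp add: b_def algebra_simps)
    hence "k * sqrt_iteration b n = sqrt_iteration b n * k" for n by (rule sqrt_iteration_commute)
    moreover have "(\<lambda>n. k * sqrt_iteration b n) \<longlonglongrightarrow> k * y" "(\<lambda>n. sqrt_iteration b n * k) \<longlonglongrightarrow> y * k"
      by (intro tendsto_intros y)+
    ultimately have "k * y = y * k" using LIMSEQ_unique by simp
    thus ?thesis by (simp add: s_def algebra_simps)
  qed
  ultimately show thesis using that by blast
qed

end

section \<open>The algebra of bounded operators\<close>

text \<open>The complex-linear maps form a closed subspace of the real-linear ones, from which they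
  inherit norm and completeness.\<close>

typedef (overloaded) 'x bounded_op =
  "{T :: 'x::complex_normed_vector \<Rightarrow>\<^sub>L 'x. \<forall>c x. T (c *\<^sub>C x) = c *\<^sub>C T x}"
  morphisms to_blinfun of_blinfun
  by (rule exI[of _ 0]) simp

definition apply_op :: "'x::complex_normed_vector bounded_op \<Rightarrow> 'x \<Rightarrow> 'x" where
  "apply_op T = blinfun_apply (to_blinfun T)"

lemma apply_op_eqI: "(\<And>x. apply_op S x = apply_op T x) \<Longrightarrow> S = T"
  unfolding apply_op_def by (metis blinfun_eqI to_blinfun_inject)

lemma apply_op_scaleC: "apply_op T (c *\<^sub>C x) = c *\<^sub>C apply_op T x"
  using to_blinfun[of T] by (simp add: apply_op_def)

lemma apply_op_add: "apply_op T (x + y) = apply_op T x + apply_op T y"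
  by (simp add: apply_op_def blinfun.add_right)

lemma bounded_op_exists:
  assumes "\<And>x y. f (x + y) = f x + f y" "\<And>c x. f (c *\<^sub>C x) = c *\<^sub>C f x"
    and "\<And>x. norm (f x) \<le> K * norm x"
  shows "\<exists>T. apply_op T = (f :: 'x::complex_normed_vector \<Rightarrow> 'x)"
proof -
  have "bounded_linear f"
    by (rule bounded_linear_intro[of f K])
      (use assms in \<open>simp_all add: mult.commute flip: scaleC_of_real\<close>)
  hence "blinfun_apply (Blinfun f) = f" by (rule bounded_linear_Blinfun_apply)
  with assms(2) have "apply_op (of_blinfun (Blinfun f)) = f"
    by (simp add: apply_op_def of_blinfun_inverse)
  thus ?thesis by blast
qed

text \<open>The operator with underlying map \<open>f\<close>, provided that \<open>f\<close> is complex-linear and bounded;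
  otherwise an unspecified operator.\<close>

definition op_of :: "('x::complex_normed_vector \<Rightarrow> 'x) \<Rightarrow> 'x bounded_op" where
  "op_of f = (SOME T. apply_op T = f)"

lemma apply_op_of:
  assumes "\<And>x y. f (x + y) = f x + f y" "\<And>c x. f (c *\<^sub>C x) = c *\<^sub>C f x"
    and "\<And>x. norm (f x) \<le> K * norm x"
  shows "apply_op (op_of f) = f"
  unfolding op_of_def by (rule someI_ex) (rule bounded_op_exists[OF assms])

instantiation bounded_op :: (complex_normed_vector) real_normed_vector
begin

definition "0 = of_blinfun 0"
definition "S + T = of_blinfun (to_blinfun S + to_blinfun T)"
definition "S - T = of_blinfun (to_blinfun S - to_blinfun T)"
definition "- T = of_blinfun (- to_blinfun T)"
definition "r *\<^sub>R T = of_blinfun (r *\<^sub>R to_blinfun T)"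
definition "norm T = norm (to_blinfun T)"
definition "dist S T = norm (S - T :: 'a bounded_op)"
definition "sgn T = inverse (norm T) *\<^sub>R (T :: 'a bounded_op)"
definition "(uniformity :: ('a bounded_op \<times> 'a bounded_op) filter)
  = (INF e\<in>{0<..}. principal {(x, y). dist x y < e})"
definition "open (X :: 'a bounded_op set) =
  (\<forall>x\<in>X. \<forall>\<^sub>F (x', y) in uniformity. x' = x \<longrightarrow> y \<in> X)"

lemma to_blinfun_simps:
  "to_blinfun 0 = 0" "to_blinfun (S + T) = to_blinfun S + to_blinfun T"
  "to_blinfun (S - T) = to_blinfun S - to_blinfun T" "to_blinfun (- T) = - to_blinfun T"
  "to_blinfun (r *\<^sub>R T) = r *\<^sub>R to_blinfun T"
proof -
  have r: "r *\<^sub>R c *\<^sub>C x = c *\<^sub>C r *\<^sub>R x" for c and x :: 'a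
    by (simp add: scaleC_scaleC mult.commute flip: scaleC_of_real)
  show "to_blinfun 0 = 0" "to_blinfun (S + T) = to_blinfun S + to_blinfun T"
    "to_blinfun (S - T) = to_blinfun S - to_blinfun T" "to_blinfun (- T) = - to_blinfun T"
    "to_blinfun (r *\<^sub>R T) = r *\<^sub>R to_blinfun T"
    using to_blinfun[of S] to_blinfun[of T]
    by (simp_all add: zero_bounded_op_def plus_bounded_op_def minus_bounded_op_def
        uminus_bounded_op_def scaleR_bounded_op_def of_blinfun_inverse blinfun.bilinear_simps
        scaleC_add_right scaleC_diff_right r)
qed

instance
proof
  fix R S T :: "'a bounded_op" and r s :: real
  show "R + S + T = R + (S + T)" "R + S = S + R" "0 + T = T" "- T + T = 0" "S - T = S + - T"
    "r *\<^sub>R (S + T) = r *\<^sub>R S + r *\<^sub>R T" "(r + s) *\<^sub>R T = r *\<^sub>R T + s *\<^sub>R T"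
    "r *\<^sub>R s *\<^sub>R T = (r * s) *\<^sub>R T" "1 *\<^sub>R T = T"
    by (simp_all add: to_blinfun_simps scaleR_add_left scaleR_add_right add_ac flip: to_blinfun_inject)
  show "dist S T = norm (S - T)" by (rule dist_bounded_op_def)
  show "(norm T = 0) = (T = 0)"
    by (simp add: norm_bounded_op_def to_blinfun_simps flip: to_blinfun_inject)
  show "norm (S + T) \<le> norm S + norm T" "norm (r *\<^sub>R T) = \<bar>r\<bar> * norm T"
    by (simp_all add: norm_bounded_op_def to_blinfun_simps norm_triangle_ineq)
  show "sgn T = inverse (norm T) *\<^sub>R T" by (rule sgn_bounded_op_def)
  show "(uniformity :: ('a bounded_op \<times> 'a bounded_op) filter)
      = (INF e\<in>{0<..}. principal {(x, y). dist x y < e})"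
    by (rule uniformity_bounded_op_def)
  show "open X = (\<forall>x\<in>X. \<forall>\<^sub>F (x', y) in uniformity. x' = x \<longrightarrow> y \<in> X)"
    for X :: "'a bounded_op set"
    by (rule open_bounded_op_def)
qed

end

lemma norm_apply_op: "norm (apply_op T x) \<le> norm T * norm x"
  unfolding apply_op_def norm_bounded_op_def by (rule norm_blinfun)

lemma norm_op_le: "0 \<le> b \<Longrightarrow> (\<And>x. norm (apply_op T x) \<le> b * norm x) \<Longrightarrow> norm T \<le> b"
  unfolding apply_op_def norm_bounded_op_def by (rule norm_blinfun_bound)

lemma isometric_to_blinfun: "dist (to_blinfun S) (to_blinfun T) = dist S T"
  by (simp add: dist_norm norm_bounded_op_def to_blinfun_simps)

lemma apply_op_simps:
  "apply_op 0 x = 0" "apply_op (S + T) x = apply_op S x + apply_op T x"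
  "apply_op (S - T) x = apply_op S x - apply_op T x" "apply_op (- T) x = - apply_op T x"
  "apply_op (r *\<^sub>R T) x = r *\<^sub>R apply_op T x"
  by (simp_all add: apply_op_def to_blinfun_simps blinfun.bilinear_simps)

instance bounded_op :: ("{complex_normed_vector, banach}") banach
proof
  fix X :: "nat \<Rightarrow> 'a bounded_op"
  assume "Cauchy X"
  hence "Cauchy (\<lambda>n. to_blinfun (X n))"
    by (simp add: Cauchy_def isometric_to_blinfun)
  then obtain T where T: "(\<lambda>n. to_blinfun (X n)) \<longlonglongrightarrow> T"
    using Cauchy_convergent convergent_def by blast
  have "blinfun_apply T (c *\<^sub>C x) = c *\<^sub>C T x" for c x
  proof -
    have X_apply: "(\<lambda>n. apply_op (X n) y) \<longlonglongrightarrow> T y" for y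
      unfolding apply_op_def by (intro tendsto_intros T)
    have "bounded_linear (\<lambda>y. c *\<^sub>C (y :: 'a))"
      by (rule bounded_linear_intro[of _ "cmod c"])
        (simp_all add: scaleC_add_right scaleC_scaleC norm_scaleC mult.commute flip: scaleC_of_real)
    from bounded_linear.tendsto[OF this X_apply]
    have "(\<lambda>n. apply_op (X n) (c *\<^sub>C x)) \<longlonglongrightarrow> c *\<^sub>C T x" by (simp add: apply_op_scaleC)
    thus ?thesis using X_apply LIMSEQ_unique by blast
  qed
  hence "to_blinfun (of_blinfun T) = T" by (simp add: of_blinfun_inverse)
  hence "(\<lambda>n. dist (X n) (of_blinfun T)) \<longlonglongrightarrow> 0"
    using T[THEN tendsto_dist_iff[THEN iffD1]] isometric_to_blinfun[of _ "of_blinfun T"] by simp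
  hence "X \<longlonglongrightarrow> of_blinfun T" by (rule tendsto_dist_iff[THEN iffD2])
  thus "convergent X" by (rule convergentI)
qed

instantiation bounded_op :: (complex_normed_vector) complex_normed_vector
begin

definition "c *\<^sub>C T = op_of (\<lambda>x. c *\<^sub>C apply_op T x)"

lemma apply_op_scaleC_left: "apply_op (c *\<^sub>C T) = (\<lambda>x. c *\<^sub>C apply_op T x)"
  unfolding scaleC_bounded_op_def
proof (rule apply_op_of[where K = "cmod c * norm T"])
  show "norm (c *\<^sub>C apply_op T x) \<le> cmod c * norm T * norm x" for x
    using mult_left_mono[OF norm_apply_op[of T x] norm_ge_zero[of c]]
    by (simp add: norm_scaleC mult.assoc)
  show "c *\<^sub>C apply_op T (d *\<^sub>C x) = d *\<^sub>C c *\<^sub>C apply_op T x" for d x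
    by (simp add: apply_op_scaleC scaleC_scaleC mult.commute)
qed (simp add: apply_op_add scaleC_add_right)

instance
proof
  fix c d :: complex and r :: real and S T :: "'a bounded_op"
  show "c *\<^sub>C (S + T) = c *\<^sub>C S + c *\<^sub>C T" "(c + d) *\<^sub>C T = c *\<^sub>C T + d *\<^sub>C T"
    "c *\<^sub>C d *\<^sub>C T = (c * d) *\<^sub>C T" "complex_of_real r *\<^sub>C T = r *\<^sub>R T"
    by (auto intro!: apply_op_eqI simp: apply_op_scaleC_left apply_op_simps scaleC_add_right
        scaleC_add_left scaleC_scaleC scaleC_of_real)
  have le: "norm (e *\<^sub>C R) \<le> cmod e * norm R" for e and R :: "'a bounded_op"
    by (rule norm_op_le)
      (use mult_left_mono[OF norm_apply_op norm_ge_zero[of e]] in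
        \<open>auto simp: apply_op_scaleC_left norm_scaleC mult.assoc\<close>)
  show "norm (c *\<^sub>C T) = cmod c * norm T"
  proof (cases "c = 0")
    case True
    thus ?thesis using le[of 0 T] by simp
  next
    case False
    have "(1 / c) *\<^sub>C c *\<^sub>C T = T"
      using False by (auto intro!: apply_op_eqI simp: apply_op_scaleC_left scaleC_scaleC)
    hence "norm T \<le> cmod (1 / c) * norm (c *\<^sub>C T)" using le[of "1 / c" "c *\<^sub>C T"] by simp
    hence "cmod c * norm T \<le> norm (c *\<^sub>C T)"
      using False by (simp add: norm_divide field_simps)
    with le[of c T] show ?thesis by simp
  qed
qed

end

instantiation bounded_op :: ("{complex_normed_vector, banach}") unital_banach_algebra
begin

definition "1 = op_of id"
definition "S * T = op_of (apply_op S \<circ> apply_op T)"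

lemma apply_op_one: "apply_op 1 = id"
  unfolding one_bounded_op_def by (rule apply_op_of[where K = 1]) simp_all

lemma apply_op_times: "apply_op (S * T) = apply_op S \<circ> apply_op T"
  unfolding times_bounded_op_def
proof (rule apply_op_of[where K = "norm S * norm T"])
  fix x
  show "norm ((apply_op S \<circ> apply_op T) x) \<le> norm S * norm T * norm x"
    using norm_apply_op[of S "apply_op T x"] mult_left_mono[OF norm_apply_op[of T x] norm_ge_zero[of S]]
    by (simp add: mult.assoc)
qed (simp_all add: apply_op_add apply_op_scaleC)

instance
proof
  fix c :: complex and r :: real and R S T :: "'a bounded_op"
  show "R * S * T = R * (S * T)" "1 * T = T" "T * 1 = T" "(R + S) * T = R * T + S * T"
    "R * (S + T) = R * S + R * T" "(r *\<^sub>R S) * T = r *\<^sub>R (S * T)" "S * (r *\<^sub>R T) = r *\<^sub>R (S * T)"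
    "(c *\<^sub>C S) * T = c *\<^sub>C (S * T)" "S * (c *\<^sub>C T) = c *\<^sub>C (S * T)"
    by (auto intro!: apply_op_eqI simp: apply_op_one apply_op_times apply_op_simps apply_op_add
        apply_op_scaleC_left apply_op_scaleC simp flip: scaleC_of_real)
  show "norm (1 :: 'a bounded_op) \<le> 1"
    by (rule norm_op_le) (simp_all add: apply_op_one)
  show "norm (S * T) \<le> norm S * norm T"
  proof (rule norm_op_le)
    fix x
    show "norm (apply_op (S * T) x) \<le> norm S * norm T * norm x"
      using norm_apply_op[of S "apply_op T x"]
        mult_left_mono[OF norm_apply_op[of T x] norm_ge_zero[of S]]
      by (simp add: mult.assoc apply_op_times)
  qed simp
qed

end

lemmas apply_op_algebra = apply_op_simps apply_op_scaleC_left apply_op_one apply_op_times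

lemma bounded_bilinear_apply_op: "bounded_bilinear apply_op"
proof
  show "\<exists>K. \<forall>T x. norm (apply_op T x) \<le> norm T * norm x * K"
    by (intro exI[of _ 1]) (simp add: norm_apply_op)
  show "apply_op T (r *\<^sub>R x) = r *\<^sub>R apply_op T x" for T r and x :: 'a
    using apply_op_scaleC[of T "complex_of_real r" x] by (simp add: scaleC_of_real)
qed (simp_all add: apply_op_simps apply_op_add)

lemma apply_op_inverse_pair:
  assumes "inverse_pair S R"
  shows "apply_op S (apply_op R x) = x"
proof -
  have "apply_op S (apply_op R x) = apply_op (S * R) x" by (simp add: apply_op_times)
  with assms show ?thesis by (simp add: inverse_pair_def apply_op_one)
qed

section \<open>Positive elements of a C*-algebra\<close>

lemma norm_star: "norm (star a) = norm (a::'a::cstar_algebra)"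
proof -
  have le: "norm b \<le> norm (star b)" for b :: 'a
  proof (cases "b = 0")
    case False
    have "norm b * norm b \<le> norm (star b) * norm b"
      using cstar_identity[of b] norm_mult_ineq[of "star b" b] by (simp add: power2_eq_square)
    thus ?thesis using False by simp
  qed simp
  from le[of a] le[of "star a"] show ?thesis by (simp add: star_star)
qed

text \<open>The unitization acting on the algebra from the left. The operator norm is a C*-seminorm on the
  unitization that extends the norm of the algebra, so the C*-norm of the unitization never has
  to be constructed.\<close>

definition left_op :: "'a::cstar_algebra \<times> complex \<Rightarrow> 'a bounded_op" where
  "left_op x = op_of (\<lambda>b. fst x * b + snd x *\<^sub>C b)"

lemma apply_left_op: "apply_op (left_op (a, c)) b = a * b + c *\<^sub>C b"
proof -
  have "apply_op (op_of (\<lambda>b. a * b + c *\<^sub>C b)) = (\<lambda>b. a * b + c *\<^sub>C b)"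
  proof (rule apply_op_of[where K = "norm a + cmod c"])
    fix b
    show "norm (a * b + c *\<^sub>C b) \<le> (norm a + cmod c) * norm b"
      using norm_triangle_mono[OF norm_mult_ineq[of a b] order_refl[of "norm (c *\<^sub>C b)"]]
      by (simp add: norm_scaleC distrib_right)
  qed (simp_all add: distrib_left scaleC_add_right cstar_algebra_class.mult_scaleC_right scaleC_scaleC mult.commute)
  thus ?thesis by (simp add: left_op_def)
qed

lemma left_op_one: "left_op (0, 1) = 1"
  by (rule apply_op_eqI) (simp add: apply_left_op apply_op_one)

lemma left_op_add: "left_op (a, c) + left_op (b, d) = left_op (a + b, c + d)"
  by (rule apply_op_eqI)
    (simp add: apply_left_op apply_op_simps distrib_right scaleC_add_left)

lemma left_op_diff: "left_op (a, c) - left_op (b, d) = left_op (a - b, c - d)"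
  by (rule apply_op_eqI)
    (simp add: apply_left_op apply_op_simps left_diff_distrib scaleC_diff_left)

lemma left_op_scaleC: "z *\<^sub>C left_op (a, c) = left_op (z *\<^sub>C a, z * c)"
  by (rule apply_op_eqI)
    (simp add: apply_left_op apply_op_scaleC_left cstar_algebra_class.mult_scaleC_left scaleC_add_right scaleC_scaleC)

lemma left_op_scaleR: "r *\<^sub>R left_op (a, c) = left_op (r *\<^sub>R a, complex_of_real r * c)"
  using left_op_scaleC[of "complex_of_real r" a c] by (simp add: scaleC_of_real)

lemma left_op_mult: "left_op x * left_op y = left_op (unitization_mult x y)"
proof -
  obtain a c b d where x: "x = (a, c)" and y: "y = (b, d)" by (cases x, cases y) auto
  show ?thesis unfolding x y unitization_mult.simps
    by (rule apply_op_eqI)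
      (simp add: apply_left_op apply_op_times distrib_left distrib_right scaleC_add_right
        cstar_algebra_class.mult_scaleC_left cstar_algebra_class.mult_scaleC_right scaleC_scaleC
        mult.assoc)
qed

lemma norm_left_op: "norm (left_op (a, 0)) = norm (a :: 'a::cstar_algebra)"
proof (rule antisym)
  show "norm (left_op (a, 0)) \<le> norm a"
    by (rule norm_op_le) (simp_all add: apply_left_op norm_mult_ineq)
  show "norm a \<le> norm (left_op (a, 0))"
  proof (cases "a = 0")
    case False
    have "norm a * norm a = norm (apply_op (left_op (a, 0)) (star a))"
      using cstar_identity[of "star a"]
      by (simp add: apply_left_op star_star norm_star power2_eq_square)
    also have "\<dots> \<le> norm (left_op (a, 0)) * norm a"
      using norm_apply_op[of _ "star a"] by (simp add: norm_star)
    finally show ?thesis using False by simp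
  qed simp
qed

definition symmetric_left_ops :: "'a::cstar_algebra bounded_op set" where
  "symmetric_left_ops = {left_op (a, complex_of_real t) |a t. star a = a}"

text \<open>For \<open>v = (h + i t) b\<close> one has \<open>v* v = b* ((h\<^sup>2 + t\<^sup>2) b)\<close>, so the C*-identity at \<open>v\<close> bounds
  \<open>\<parallel>v\<parallel>\<^sup>2\<close> by \<open>\<parallel>h\<^sup>2 + t\<^sup>2\<parallel> \<parallel>b\<parallel>\<^sup>2\<close>.\<close>

interpretation left_mult: symmetric_family "symmetric_left_ops :: 'a::cstar_algebra bounded_op set"
proof
  have star_zero: "star (0::'a) = 0" using star_scaleC[of 0 0] by simp
  have star_scaleR: "star (t *\<^sub>R a) = t *\<^sub>R star a" for t and a :: 'a
    using star_scaleC[of "complex_of_real t" a] by (simp add: scaleC_of_real)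
  show "(1::'a bounded_op) \<in> symmetric_left_ops"
    unfolding symmetric_left_ops_def mem_Collect_eq
    by (intro exI[of _ 0] exI[of _ 1]) (simp add: left_op_one star_zero)
  fix h k :: "'a bounded_op" and t :: real
  assume "h \<in> symmetric_left_ops"
  then obtain a s where h: "h = left_op (a, complex_of_real s)" and a: "star a = a"
    by (auto simp: symmetric_left_ops_def)
  {
    assume "k \<in> symmetric_left_ops"
    then obtain b r where "k = left_op (b, complex_of_real r)" "star b = b"
      by (auto simp: symmetric_left_ops_def)
    thus "h + k \<in> symmetric_left_ops" unfolding symmetric_left_ops_def mem_Collect_eq
      by (intro exI[of _ "a + b"] exI[of _ "s + r"]) (simp add: h a left_op_add star_add)
  }
  show "t *\<^sub>R h \<in> symmetric_left_ops" unfolding symmetric_left_ops_def mem_Collect_eq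
    by (intro exI[of _ "t *\<^sub>R a"] exI[of _ "t * s"])
      (simp add: h a star_scaleR left_op_scaleR)
  show "h * h \<in> symmetric_left_ops" unfolding symmetric_left_ops_def mem_Collect_eq
    by (intro exI[of _ "a * a + s *\<^sub>R a + s *\<^sub>R a"] exI[of _ "s * s"])
      (simp add: h a left_op_mult star_mult star_add star_scaleR scaleC_of_real)
  define c where "c = complex_of_real s + \<i> * complex_of_real t"
  have ht: "h + (\<i> * complex_of_real t) *\<^sub>C 1 = left_op (a, c)"
    by (simp add: h left_op_scaleC left_op_add c_def flip: left_op_one)
  have "t\<^sup>2 *\<^sub>R (1::'a bounded_op) = left_op (0, complex_of_real (t\<^sup>2))"
    by (simp add: left_op_scaleR flip: left_op_one)
  hence "h * h + t\<^sup>2 *\<^sub>R 1 =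
      left_op (a * a + complex_of_real s *\<^sub>C a + complex_of_real s *\<^sub>C a,
        complex_of_real s * complex_of_real s + complex_of_real (t\<^sup>2))"
    by (simp add: h left_op_mult left_op_add)
  also have "complex_of_real s * complex_of_real s + complex_of_real (t\<^sup>2) = cnj c * c"
    by (simp add: c_def complex_eq_iff power2_eq_square)
  also have "a * a + complex_of_real s *\<^sub>C a + complex_of_real s *\<^sub>C a = a * a + (cnj c *\<^sub>C a + c *\<^sub>C a)"
    by (simp add: c_def add.assoc flip: scaleC_add_left)
  finally have sq: "h * h + t\<^sup>2 *\<^sub>R 1 = left_op (a, cnj c) * left_op (a, c)"
    by (simp add: left_op_mult add.assoc)
  have "norm (left_op (a, c)) \<le> sqrt (norm (h * h + t\<^sup>2 *\<^sub>R 1))"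
  proof (rule norm_op_le)
    fix b
    define v where "v = apply_op (left_op (a, c)) b"
    have "star v = star b * a + cnj c *\<^sub>C star b"
      by (simp add: v_def apply_left_op star_add star_mult star_scaleC a)
    hence "star v * v = star b * apply_op (left_op (a, cnj c)) v"
      by (simp add: apply_left_op distrib_left distrib_right mult.assoc
          cstar_algebra_class.mult_scaleC_left cstar_algebra_class.mult_scaleC_right)
    also have "apply_op (left_op (a, cnj c)) v = apply_op (h * h + t\<^sup>2 *\<^sub>R 1) b"
      by (simp add: sq v_def apply_op_times)
    finally have "(norm v)\<^sup>2 = norm (star b * apply_op (h * h + t\<^sup>2 *\<^sub>R 1) b)"
      using cstar_identity[of v] by simp
    also have "\<dots> \<le> norm b * norm (apply_op (h * h + t\<^sup>2 *\<^sub>R 1) b)"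
      using norm_mult_ineq[of "star b"] by (simp add: norm_star)
    also have "\<dots> \<le> norm b * (norm (h * h + t\<^sup>2 *\<^sub>R 1) * norm b)"
      by (rule mult_left_mono[OF norm_apply_op norm_ge_zero])
    also have "\<dots> = (sqrt (norm (h * h + t\<^sup>2 *\<^sub>R 1)) * norm b)\<^sup>2"
      by (simp add: power2_eq_square)
    finally show "norm (apply_op (left_op (a, c)) b) \<le> sqrt (norm (h * h + t\<^sup>2 *\<^sub>R 1)) * norm b"
      unfolding v_def by (rule power2_le_imp_le) simp
  qed simp
  thus "(norm (h + (\<i> * complex_of_real t) *\<^sub>C 1))\<^sup>2 \<le> norm (h * h + t\<^sup>2 *\<^sub>R 1)"
    unfolding ht by (rule power_mono[THEN order_trans]) simp_all
qed

text \<open>The left action is a unital homomorphism, so it carries inverses to inverses.\<close>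

lemma alg_spectrum_left_op: "alg_spectrum (left_op (a, 0)) \<subseteq> spectrum a"
proof
  fix z assume z: "z \<in> alg_spectrum (left_op (a, 0))"
  show "z \<in> spectrum a"
  proof (rule ccontr)
    assume "z \<notin> spectrum a"
    then obtain w where "unitization_mult (a, - z) w = (0, 1)" "unitization_mult w (a, - z) = (0, 1)"
      unfolding spectrum_def by blast
    hence "inverse_pair (left_op (a, - z)) (left_op w)"
      by (simp add: inverse_pair_def left_op_mult left_op_one)
    moreover have "left_op (a, 0) - z *\<^sub>C 1 = left_op (a, - z)"
      by (simp add: left_op_scaleC left_op_diff flip: left_op_one)
    ultimately show False using z unfolding alg_spectrum_def by auto
  qed
qed

lemma positive_imp_pos_left_op: "positive a \<Longrightarrow> left_mult.pos (left_op (a, 0))"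
proof -
  assume a: "positive a"
  have "left_op (a, complex_of_real 0) \<in> symmetric_left_ops"
    unfolding symmetric_left_ops_def mem_Collect_eq
    using a[unfolded positive_def, THEN conjunct1] by blast
  moreover have "spectrum a \<subseteq> complex_of_real ` {0..}"
    using a unfolding positive_def by (rule conjunct2)
  ultimately show ?thesis
    using order_trans[OF alg_spectrum_left_op] by (simp add: left_mult.pos_def)
qed

lemma norm_le_norm_add_positive:
  assumes "positive p" "positive q"
  shows "norm p \<le> norm (p + q)"
  using left_mult.norm_le_norm_add[OF assms[THEN positive_imp_pos_left_op]]
  by (simp add: left_op_add norm_left_op)

lemma norm_diff_positive_le_max:
  assumes "positive p" "positive q"
  shows "norm (p - q) \<le> max (norm p) (norm q)"
  using left_mult.norm_diff_le_max[OF assms[THEN positive_imp_pos_left_op]]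
  by (simp add: left_op_diff norm_left_op)

section \<open>Inner products and adjoints\<close>

lemma Baire_interior:
  fixes E :: "nat \<Rightarrow> 'x::{real_normed_vector, banach} set"
  assumes "\<And>n. closed (E n)" "(\<Union>n. E n) = UNIV"
  obtains n where "interior (E n) \<noteq> {}"
proof (rule ccontr)
  assume "\<not> thesis"
  with that have "\<And>n. interior (E n) = {}" by blast
  hence "euclidean interior_of \<Union>(range E) = {}"
    using assms(1)
    by (intro Baire_category_alt disjI1 completely_metrizable_space_euclidean) (auto simp: euclidean_interior_of)
  thus False using assms(2) by (simp add: euclidean_interior_of)
qed

context hilbert_module
begin

lemma ip_add_left: "ip (x + y) z = ip x z + ip y z"
  by (metis ip_add_right star_add star_ip)

lemma ip_scaleC_left: "ip (c *\<^sub>C x) y = cnj c *\<^sub>C ip x y"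
  by (metis ip_scaleC_right star_ip star_scaleC)

lemma ip_scaleR_right: "ip x (r *\<^sub>R y) = r *\<^sub>R ip x y"
  using ip_scaleC_right[of x "complex_of_real r" y] by (simp add: scaleC_of_real)

lemma ip_scaleR_left: "ip (r *\<^sub>R x) y = r *\<^sub>R ip x y"
  using ip_scaleC_left[of "complex_of_real r" x y] by (simp add: scaleC_of_real)

lemma ip_act_left: "ip (act x a) y = star a * ip x y"
  by (metis ip_act_right star_ip star_mult)

lemma ip_zero [simp]: "ip x 0 = 0" "ip 0 x = 0"
  using ip_scaleR_right[of x 0 0] ip_scaleR_left[of 0 0 x] by simp_all

lemma ip_diff_right: "ip x (y - z) = ip x y - ip x z"
  using ip_add_right[of x y "(-1) *\<^sub>R z"] ip_scaleR_right[of x "-1" z] by simp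

lemma ip_diff_left: "ip (x - y) z = ip x z - ip y z"
  using ip_add_left[of x "(-1) *\<^sub>R y" z] ip_scaleR_left[of "-1" y z] by simp

lemma norm_ip_self: "norm (ip x x) = (norm x)\<^sup>2"
  by (simp add: norm_eq)

lemma ip_eqI:
  assumes "\<And>z. ip x z = ip y z"
  shows "x = y"
proof -
  have "ip (x - y) (x - y) = 0" using assms by (simp add: ip_diff_left)
  thus ?thesis using ip_definite by fastforce
qed

lemma norm_ip_self_le_add: "norm (ip x x) \<le> norm (ip x x + ip y y)"
  by (intro norm_le_norm_add_positive ip_positive)

text \<open>For unit vectors, polarization writes \<open>2 (\<langle>u, v\<rangle> + \<langle>v, u\<rangle>)\<close> as the difference of two positive
  elements of norm at most \<open>4\<close>, which has again norm at most \<open>4\<close>; the triangle inequality alone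
  would lose a factor of two.\<close>

lemma norm_ip_symmetrized: "norm (ip x y + ip y x) \<le> 2 * (norm x * norm y)"
proof (cases "x = 0 \<or> y = 0")
  case False
  hence xy: "norm x > 0" "norm y > 0" by auto
  have unit: "norm (ip u v + ip v u) \<le> 2" if u: "norm u = 1" and v: "norm v = 1" for u v
  proof -
    have "2 *\<^sub>R (ip u v + ip v u) = ip (u + v) (u + v) - ip (u - v) (u - v)"
      by (simp add: ip_add_left ip_add_right ip_diff_left ip_diff_right scaleR_2)
    hence "2 * norm (ip u v + ip v u) = norm (ip (u + v) (u + v) - ip (u - v) (u - v))"
      by (metis norm_scaleR abs_numeral)
    also have "\<dots> \<le> max ((norm (u + v))\<^sup>2) ((norm (u - v))\<^sup>2)"
      unfolding norm_ip_self[symmetric] by (intro norm_diff_positive_le_max ip_positive)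
    also have "\<dots> \<le> 2\<^sup>2"
      using norm_triangle_ineq[of u v] norm_triangle_ineq4[of u v] u v
      by (intro max.boundedI power_mono) auto
    finally show ?thesis by simp
  qed
  have "ip x y + ip y x =
      (norm x * norm y) *\<^sub>R (ip (x /\<^sub>R norm x) (y /\<^sub>R norm y) + ip (y /\<^sub>R norm y) (x /\<^sub>R norm x))"
    using xy by (simp add: ip_scaleR_left ip_scaleR_right scaleR_add_right field_simps)
  hence "norm (ip x y + ip y x) =
      (norm x * norm y) * norm (ip (x /\<^sub>R norm x) (y /\<^sub>R norm y) + ip (y /\<^sub>R norm y) (x /\<^sub>R norm x))"
    using xy by simp
  also have "\<dots> \<le> (norm x * norm y) * 2"
    using xy by (intro mult_left_mono unit) auto
  finally show ?thesis by simp
qed auto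

text \<open>With \<open>c = \<langle>x, y\<rangle>\<close> the element \<open>\<langle>y, x c\<rangle> = c* c\<close> is self-adjoint, so the symmetrized inequality
  for \<open>x c\<close> and \<open>y\<close> bounds it without loss: \<open>\<parallel>c\<parallel>\<^sup>2 \<le> \<parallel>x c\<parallel> \<parallel>y\<parallel> \<le> \<parallel>x\<parallel> \<parallel>c\<parallel> \<parallel>y\<parallel>\<close>.\<close>

lemma Cauchy_Schwarz: "norm (ip x y) \<le> norm x * norm y"
proof -
  define c where "c = ip x y"
  have "(norm (act x c))\<^sup>2 = norm (star c * ip x x * c)"
    by (simp add: ip_act_left ip_act_right mult.assoc flip: norm_ip_self)
  also have "\<dots> \<le> norm (star c * ip x x) * norm c" by (rule norm_mult_ineq)
  also have "\<dots> \<le> (norm (star c) * norm (ip x x)) * norm c"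
    by (intro mult_right_mono norm_mult_ineq norm_ge_zero)
  also have "\<dots> = (norm c * norm x)\<^sup>2"
    by (simp add: norm_star norm_ip_self power2_eq_square)
  finally have act_le: "norm (act x c) \<le> norm c * norm x"
    by (rule power2_le_imp_le) simp
  have "ip (act x c) y + ip y (act x c) = 2 *\<^sub>R (star c * c)"
    using star_ip[of x y] by (simp add: ip_act_left ip_act_right c_def scaleR_2)
  hence "2 * (norm c)\<^sup>2 = norm (ip (act x c) y + ip y (act x c))"
    by (simp add: cstar_identity)
  also have "\<dots> \<le> 2 * (norm (act x c) * norm y)" by (rule norm_ip_symmetrized)
  also have "\<dots> \<le> 2 * (norm c * norm x * norm y)"
    by (intro mult_left_mono mult_right_mono act_le) auto
  finally have "norm c * norm c \<le> norm c * (norm x * norm y)"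
    by (simp add: power2_eq_square mult.assoc)
  thus ?thesis unfolding c_def by (cases "norm (ip x y) = 0") auto
qed

lemma bounded_bilinear_ip: "bounded_bilinear ip"
proof
  show "\<exists>K. \<forall>x y. norm (ip x y) \<le> norm x * norm y * K"
    by (intro exI[of _ 1]) (simp add: Cauchy_Schwarz)
qed (simp_all add: ip_add_left ip_add_right ip_scaleR_left ip_scaleR_right)

text \<open>A relation between operators is easier to compose than \<^const>\<open>adj\<close>, which is a definite
  description and presupposes that an adjoint exists.\<close>

definition adjoint_pair :: "'h bounded_op \<Rightarrow> 'h bounded_op \<Rightarrow> bool" where
  "adjoint_pair S T \<longleftrightarrow> (\<forall>x y. ip (apply_op S x) y = ip x (apply_op T y))"

lemma adjoint_pairD: "adjoint_pair S T \<Longrightarrow> ip (apply_op S x) y = ip x (apply_op T y)"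
  by (simp add: adjoint_pair_def)

lemma adjoint_pair_sym: "adjoint_pair S T \<Longrightarrow> adjoint_pair T S"
  unfolding adjoint_pair_def by (metis star_ip)

text \<open>The maps \<open>y \<mapsto> \<langle>f x, y\<rangle>\<close> for \<open>\<parallel>x\<parallel> \<le> 1\<close> are bounded by \<open>\<parallel>g y\<parallel>\<close> at each \<open>y\<close>, so by Baire they
  are uniformly bounded on some ball; then test them on multiples of \<open>f x\<close>.\<close>

lemma adjoint_bounded:
  assumes fg: "\<And>x y. ip (f x) y = ip x (g y)"
  obtains K where "\<And>x. norm (f x) \<le> K * norm x"
proof -
  have f_scaleR: "f (r *\<^sub>R x) = r *\<^sub>R f x" for r x
    by (rule ip_eqI) (simp add: fg ip_scaleR_left)
  define E where "E n = {y. \<forall>x. norm x \<le> 1 \<longrightarrow> norm (ip (f x) y) \<le> real n}" for n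
  have "closed (E n)" for n
    unfolding E_def
    by (intro closed_Collect_all closed_Collect_imp open_Collect_const closed_Collect_le
        continuous_intros bounded_linear.continuous_on[OF bounded_bilinear.bounded_linear_right[OF bounded_bilinear_ip]])
  moreover have "(\<Union>n. E n) = UNIV"
  proof -
    have "y \<in> E (nat \<lceil>norm (g y)\<rceil>)" for y
      unfolding E_def
    proof (intro CollectI allI impI)
      fix x :: 'h assume x: "norm x \<le> 1"
      have "norm (ip (f x) y) \<le> norm x * norm (g y)" unfolding fg by (rule Cauchy_Schwarz)
      also have "\<dots> \<le> 1 * norm (g y)" using x by (intro mult_right_mono) auto
      also have "\<dots> \<le> real (nat \<lceil>norm (g y)\<rceil>)" by simp
      finally show "norm (ip (f x) y) \<le> real (nat \<lceil>norm (g y)\<rceil>)" .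
    qed
    thus ?thesis by blast
  qed
  ultimately obtain n where "interior (E n) \<noteq> {}" by (rule Baire_interior)
  then obtain y\<^sub>0 e where e: "e > 0" "cball y\<^sub>0 e \<subseteq> E n"
    by (metis all_not_in_conv mem_interior_cball)
  have bound: "norm (f x) \<le> 2 * real n / e" if x: "norm x \<le> 1" for x
  proof (cases "f x = 0")
    case False
    define v where "v = (e / norm (f x)) *\<^sub>R f x"
    have "y\<^sub>0 + v \<in> E n" "y\<^sub>0 \<in> E n" using e False by (auto simp: v_def dist_norm intro!: subsetD[OF e(2)])
    hence "norm (ip (f x) (y\<^sub>0 + v)) \<le> n" "norm (ip (f x) y\<^sub>0) \<le> n"
      using x by (simp_all add: E_def)
    moreover have "ip (f x) v = ip (f x) (y\<^sub>0 + v) - ip (f x) y\<^sub>0" by (simp add: ip_add_right)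
    ultimately have "norm (ip (f x) v) \<le> 2 * real n"
      using norm_triangle_ineq4[of "ip (f x) (y\<^sub>0 + v)" "ip (f x) y\<^sub>0"] by simp
    moreover have "norm (ip (f x) v) = e * norm (f x)"
      using False e(1) by (simp add: v_def ip_scaleR_right norm_ip_self power2_eq_square)
    ultimately show ?thesis using e(1) by (simp add: field_simps)
  qed (use e in simp)
  have "norm (f x) \<le> 2 * real n / e * norm x" for x
  proof (cases "x = 0")
    case True
    thus ?thesis using f_scaleR[of 0 0] by simp
  next
    case False
    have "norm (f ((1 / norm x) *\<^sub>R x)) \<le> 2 * real n / e" using False by (intro bound) simp
    thus ?thesis using False by (simp add: f_scaleR divide_le_eq)
  qed
  thus thesis using that by blast
qed

lemma adjoint_op_exists:
  assumes fg: "\<And>x y. ip (f x) y = ip x (g y)"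
  obtains T where "apply_op T = f"
proof -
  obtain K where "\<And>x. norm (f x) \<le> K * norm x" using adjoint_bounded[OF fg] by blast
  moreover have "f (x + y) = f x + f y" for x y
    by (rule ip_eqI) (simp add: fg ip_add_left)
  moreover have "f (c *\<^sub>C x) = c *\<^sub>C f x" for c x
    by (rule ip_eqI) (simp add: fg ip_scaleC_left)
  ultimately show thesis using that bounded_op_exists by metis
qed

lemma adjointableE:
  assumes "f \<in> adjointable ip"
  obtains T T' where "apply_op T = f" "adjoint_pair T T'"
proof -
  obtain g where g: "\<And>x y. ip (f x) y = ip x (g y)" using assms unfolding adjointable_def by blast
  obtain T where T: "apply_op T = f" using adjoint_op_exists[OF g] by blast
  have "\<And>x y. ip (g x) y = ip x (f y)" by (metis g star_ip)
  then obtain T' where "apply_op T' = g" using adjoint_op_exists by blast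
  with T g that show thesis unfolding adjoint_pair_def by metis
qed

lemma adjointableI: "adjoint_pair T T' \<Longrightarrow> apply_op T \<in> adjointable ip"
  unfolding adjoint_pair_def adjointable_def by blast

lemma adj_apply_op:
  assumes "adjoint_pair T T'"
  shows "adj ip (apply_op T) = apply_op T'"
  unfolding adj_def
proof (rule the_equality)
  show "\<forall>x y. ip (apply_op T x) y = ip x (apply_op T' y)" using assms by (simp add: adjoint_pair_def)
  fix S assume S: "\<forall>x y. ip (apply_op T x) y = ip x (S y)"
  show "S = apply_op T'"
  proof
    fix y
    have "ip (S y) x = ip (apply_op T' y) x" for x
      using S assms by (metis adjoint_pairD star_ip)
    thus "S y = apply_op T' y" by (rule ip_eqI)
  qed
qed

lemma adjoint_unique: "adjoint_pair T S \<Longrightarrow> adjoint_pair T S' \<Longrightarrow> S = S'"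
  using adj_apply_op by (metis apply_op_eqI)

lemma adjoint_pair_one: "adjoint_pair 1 1"
  by (simp add: adjoint_pair_def apply_op_one)

lemma adjoint_pair_add: "adjoint_pair S S' \<Longrightarrow> adjoint_pair T T' \<Longrightarrow> adjoint_pair (S + T) (S' + T')"
  by (simp add: adjoint_pair_def apply_op_simps ip_add_left ip_add_right)

lemma adjoint_pair_diff: "adjoint_pair S S' \<Longrightarrow> adjoint_pair T T' \<Longrightarrow> adjoint_pair (S - T) (S' - T')"
  by (simp add: adjoint_pair_def apply_op_simps ip_diff_left ip_diff_right)

lemma adjoint_pair_scaleC: "adjoint_pair T T' \<Longrightarrow> adjoint_pair (c *\<^sub>C T) (cnj c *\<^sub>C T')"
  by (simp add: adjoint_pair_def apply_op_scaleC_left ip_scaleC_left ip_scaleC_right)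

lemma adjoint_pair_scaleR: "adjoint_pair T T' \<Longrightarrow> adjoint_pair (r *\<^sub>R T) (r *\<^sub>R T')"
  by (simp add: adjoint_pair_def apply_op_simps ip_scaleR_left ip_scaleR_right)

lemma adjoint_pair_times: "adjoint_pair S S' \<Longrightarrow> adjoint_pair T T' \<Longrightarrow> adjoint_pair (S * T) (T' * S')"
  by (simp add: adjoint_pair_def apply_op_times)

lemma adjoint_pair_inverse:
  assumes "adjoint_pair S T" "inverse_pair S R" "inverse_pair T Q"
  shows "adjoint_pair R Q"
  unfolding adjoint_pair_def
proof (intro allI)
  fix x y
  have SR: "apply_op S (apply_op R x) = x" and TQ: "apply_op T (apply_op Q y) = y"
    using assms(2,3) by (metis inverse_pair_def apply_op_times apply_op_one comp_apply id_apply)+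
  have "ip (apply_op R x) (apply_op T (apply_op Q y)) = ip (apply_op S (apply_op R x)) (apply_op Q y)"
    using adjoint_pairD[OF assms(1)] by simp
  thus "ip (apply_op R x) y = ip x (apply_op Q y)" by (simp add: SR TQ)
qed

text \<open>\<open>\<langle>X x, X x\<rangle> = \<langle>x, X* X x\<rangle>\<close>, and Cauchy-Schwarz.\<close>

lemma norm_le_norm_adjoint_times:
  assumes "adjoint_pair X Y"
  shows "(norm X)\<^sup>2 \<le> norm (Y * X)"
proof -
  have "norm X \<le> sqrt (norm (Y * X))"
  proof (rule norm_op_le)
    fix x
    have "(norm (apply_op X x))\<^sup>2 = norm (ip x (apply_op (Y * X) x))"
      by (simp add: adjoint_pairD[OF assms] apply_op_times flip: norm_ip_self)
    also have "\<dots> \<le> norm x * (norm (Y * X) * norm x)"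
      by (intro order_trans[OF Cauchy_Schwarz] mult_left_mono norm_apply_op norm_ge_zero)
    also have "\<dots> = (sqrt (norm (Y * X)) * norm x)\<^sup>2"
      by (simp add: power2_eq_square)
    finally show "norm (apply_op X x) \<le> sqrt (norm (Y * X)) * norm x"
      by (rule power2_le_imp_le) simp
  qed simp
  thus ?thesis by (rule power_mono[THEN order_trans]) simp_all
qed

lemma norm_adjoint:
  assumes "adjoint_pair X Y"
  shows "norm X = norm Y"
proof -
  have le: "norm S \<le> norm T" if "adjoint_pair S T" for S T
  proof (cases "S = 0")
    case False
    have "norm S * norm S \<le> norm T * norm S"
      using order_trans[OF norm_le_norm_adjoint_times[OF that] norm_mult_ineq]
      by (simp add: power2_eq_square)
    thus ?thesis using False by simp
  qed simp
  show ?thesis using le[OF assms] le[OF adjoint_pair_sym[OF assms]] by simp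
qed

definition selfadjoint_ops :: "'h bounded_op set" where
  "selfadjoint_ops = {T. adjoint_pair T T}"

text \<open>The defining inequality is the previous C*-inequality for \<open>X = h + i t\<close>, whose adjoint is
  \<open>h - i t\<close>.\<close>

sublocale selfadjoint: closed_symmetric_family selfadjoint_ops
proof
  fix h k :: "'h bounded_op" and t :: real
  show "1 \<in> selfadjoint_ops"
    by (simp add: selfadjoint_ops_def adjoint_pair_one)
  show "closed selfadjoint_ops"
    unfolding closed_sequential_limits
  proof (intro allI impI, elim conjE)
    fix T L
    assume T: "\<forall>n. T n \<in> selfadjoint_ops" and L: "T \<longlonglongrightarrow> L"
    have lim: "(\<lambda>n. apply_op (T n) x) \<longlonglongrightarrow> apply_op L x" for x
      by (intro bounded_bilinear.tendsto[OF bounded_bilinear_apply_op] L tendsto_const)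
    have "ip (apply_op L x) y = ip x (apply_op L y)" for x y
    proof (rule LIMSEQ_unique)
      show "(\<lambda>n. ip (apply_op (T n) x) y) \<longlonglongrightarrow> ip (apply_op L x) y"
        by (intro bounded_bilinear.tendsto[OF bounded_bilinear_ip] lim tendsto_const)
      have "(\<lambda>n. ip x (apply_op (T n) y)) \<longlonglongrightarrow> ip x (apply_op L y)"
        by (intro bounded_bilinear.tendsto[OF bounded_bilinear_ip] lim tendsto_const)
      moreover have "ip (apply_op (T n) x) y = ip x (apply_op (T n) y)" for n
        using T by (simp add: selfadjoint_ops_def adjoint_pair_def)
      ultimately show "(\<lambda>n. ip (apply_op (T n) x) y) \<longlonglongrightarrow> ip x (apply_op L y)" by simp
    qed
    thus "L \<in> selfadjoint_ops" by (simp add: selfadjoint_ops_def adjoint_pair_def)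
  qed
  assume h: "h \<in> selfadjoint_ops"
  thus "t *\<^sub>R h \<in> selfadjoint_ops" "h * h \<in> selfadjoint_ops"
    by (simp_all add: selfadjoint_ops_def adjoint_pair_scaleR adjoint_pair_times)
  show "h + k \<in> selfadjoint_ops" if "k \<in> selfadjoint_ops"
    using h that by (simp add: selfadjoint_ops_def adjoint_pair_add)
  define w where "w = \<i> * complex_of_real t"
  have "adjoint_pair (h + w *\<^sub>C 1) (h + cnj w *\<^sub>C 1)"
    using h unfolding selfadjoint_ops_def
    by (intro adjoint_pair_add adjoint_pair_scaleC adjoint_pair_one) simp
  from norm_le_norm_adjoint_times[OF this]
  have "(norm (h + w *\<^sub>C 1))\<^sup>2 \<le> norm ((h + cnj w *\<^sub>C 1) * (h + w *\<^sub>C 1))" .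
  also have "(h + cnj w *\<^sub>C 1) * (h + w *\<^sub>C 1) = h * h + (cnj w + w) *\<^sub>C h + (cnj w * w) *\<^sub>C 1"
    by (simp add: distrib_left distrib_right scaleC_times_left scaleC_times_right scaleC_scaleC
        scaleC_add_left scaleC_add_right mult.commute add_ac)
  also have "cnj w + w = 0" by (simp add: w_def)
  also have "cnj w * w = complex_of_real (t\<^sup>2)" by (simp add: w_def power2_eq_square complex_eq_iff)
  finally show "(norm (h + (\<i> * complex_of_real t) *\<^sub>C 1))\<^sup>2 \<le> norm (h * h + t\<^sup>2 *\<^sub>R 1)"
    by (simp only: w_def scaleC_of_real scaleC_zero_left add_0_right)
qed

end

section \<open>Positive operators on a Hilbert module\<close>

context hilbert_module
begin

lemma selfadjoint_ops_iff: "T \<in> selfadjoint_ops \<longleftrightarrow> adjoint_pair T T"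
  by (simp add: selfadjoint_ops_def)

lemma pos_adjoint_pair: "selfadjoint.pos T \<Longrightarrow> adjoint_pair T T"
  using selfadjoint.pos_mem selfadjoint_ops_iff by blast

lemma inverse_pair_pos_add:
  assumes "selfadjoint.pos T" "l > 0"
  obtains R where "inverse_pair (T + l *\<^sub>R 1) R" "adjoint_pair R R"
proof -
  have "complex_of_real (- l) \<notin> alg_spectrum T"
    using selfadjoint.pos_spectrum[OF assms(1)] assms(2) by fastforce
  then obtain R where R: "inverse_pair (T + l *\<^sub>R 1) R"
    by (auto simp: alg_spectrum_def scaleC_of_real)
  have "adjoint_pair (T + l *\<^sub>R 1) (T + l *\<^sub>R 1)"
    using assms(1) by (intro adjoint_pair_add adjoint_pair_scaleR adjoint_pair_one pos_adjoint_pair)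
  from adjoint_pair_inverse[OF this R R] R show thesis using that by blast
qed

lemma pos_if_inverses:
  assumes "adjoint_pair T T" "\<And>l. l > 0 \<Longrightarrow> \<exists>R. inverse_pair (T + l *\<^sub>R 1) R"
  shows "selfadjoint.pos T"
proof (rule selfadjoint.posI)
  show "T \<in> selfadjoint_ops" using assms(1) by (simp add: selfadjoint_ops_iff)
  fix t assume t: "complex_of_real t \<in> alg_spectrum T"
  show "0 \<le> t"
  proof (rule ccontr)
    assume "\<not> 0 \<le> t"
    with assms(2)[of "- t"] t show False by (auto simp: alg_spectrum_def scaleC_of_real)
  qed
qed

text \<open>\<open>\<langle>x, (X* X + l) x\<rangle> = \<langle>X x, X x\<rangle> + l \<langle>x, x\<rangle>\<close> is a sum of positive elements, hence has norm at
  least \<open>l \<parallel>x\<parallel>\<^sup>2\<close>.\<close>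

lemma adjoint_times_self_bounded_below:
  assumes XY: "adjoint_pair X Y" and l: "l > 0"
  shows "l * norm x \<le> norm (apply_op (Y * X + l *\<^sub>R 1) x)"
proof (cases "x = 0")
  case False
  let ?z = "apply_op (Y * X + l *\<^sub>R 1) x"
  have "ip x ?z = l *\<^sub>R ip x x + ip (apply_op X x) (apply_op X x)"
    by (simp add: apply_op_algebra ip_add_right ip_scaleR_right adjoint_pairD[OF XY])
  also have "l *\<^sub>R ip x x = ip (sqrt l *\<^sub>R x) (sqrt l *\<^sub>R x)"
    using l by (simp add: ip_scaleR_left ip_scaleR_right)
  finally have "norm (ip (sqrt l *\<^sub>R x) (sqrt l *\<^sub>R x)) \<le> norm (ip x ?z)"
    using norm_ip_self_le_add by metis
  also have "\<dots> \<le> norm x * norm ?z" by (rule Cauchy_Schwarz)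
  finally have "norm x * (l * norm x) \<le> norm x * norm ?z"
    using l by (simp add: norm_ip_self power_mult_distrib power2_eq_square[of "norm x"] mult_ac)
  thus ?thesis using False by simp
qed simp

text \<open>That \<open>X* X + l\<close> is self-adjoint and bounded below does not immediately make it surjective, since closed
  submodules need not be complemented. Instead the inverse is continued: it exists for large \<open>l\<close>,
  and if it exists at \<open>l = s\<close>, then its norm is at most \<open>1 / s\<close>, so that perturbation reaches down to
  \<open>l = s / 2\<close>.\<close>

lemma pos_adjoint_times_self:
  assumes XY: "adjoint_pair X Y"
  shows "selfadjoint.pos (Y * X)"
proof (rule pos_if_inverses)
  let ?h = "Y * X"
  show "adjoint_pair ?h ?h" using XY adjoint_pair_sym adjoint_pair_times by blast
  define t\<^sub>0 where "t\<^sub>0 = norm ?h + 1"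
  have t\<^sub>0: "t\<^sub>0 > 0" by (simp add: t\<^sub>0_def add_nonneg_pos)
  \<comment> \<open>Beyond the norm of \<open>X* X\<close> the inverse exists; each step of the induction halves the bound.\<close>
  have "\<exists>R. inverse_pair (?h + t *\<^sub>R 1) R" if "t \<ge> t\<^sub>0 / 2 ^ n" for n t
    using that
  proof (induction n arbitrary: t)
    case 0
    have "complex_of_real (- t) \<notin> alg_spectrum ?h"
      using alg_spectrum_bound[of "complex_of_real (- t)" ?h] 0 by (auto simp: t\<^sub>0_def)
    thus ?case by (auto simp: alg_spectrum_def scaleC_of_real)
  next
    case (Suc n)
    define s where "s = t\<^sub>0 / 2 ^ n"
    have s: "s > 0" "s / 2 \<le> t" using t\<^sub>0 Suc.prems by (simp_all add: s_def mult.commute)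
    show ?case
    proof (cases "t \<ge> s")
      case True
      thus ?thesis using Suc.IH by (simp add: s_def)
    next
      case False
      obtain b where b: "inverse_pair (?h + s *\<^sub>R 1) b" using Suc.IH[of s] by (auto simp: s_def)
      have "norm b \<le> 1 / s"
      proof (rule norm_op_le)
        fix x
        have "apply_op (?h + s *\<^sub>R 1) (apply_op b x) = x"
          by (rule apply_op_inverse_pair[OF b])
        thus "norm (apply_op b x) \<le> 1 / s * norm x"
          using adjoint_times_self_bounded_below[OF XY s(1), of "apply_op b x"] s(1)
          by (simp add: field_simps)
      qed (use s in simp)
      moreover have "norm ((?h + t *\<^sub>R 1) - (?h + s *\<^sub>R 1)) \<le> s / 2"
      proof -
        have "(?h + t *\<^sub>R 1) - (?h + s *\<^sub>R 1) = (t - s) *\<^sub>R 1"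
          by (simp add: scaleR_diff_left)
        hence "norm ((?h + t *\<^sub>R 1) - (?h + s *\<^sub>R 1)) = \<bar>t - s\<bar> * norm (1 :: 'h bounded_op)" by simp
        also have "\<dots> \<le> \<bar>t - s\<bar> * 1" by (intro mult_left_mono norm_one_le) simp
        finally show ?thesis using False s by simp
      qed
      ultimately have "norm b * norm ((?h + t *\<^sub>R 1) - (?h + s *\<^sub>R 1)) \<le> 1 / s * (s / 2)"
        using s(1) by (intro mult_mono) auto
      also have "\<dots> = 1 / 2" using s(1) by simp
      finally show ?thesis using inverse_pair_perturbation[OF b] by blast
    qed
  qed
  moreover have "\<exists>n. t\<^sub>0 / 2 ^ n \<le> l" if l: "l > 0" for l
  proof -
    obtain n where "(1/2) ^ n < l / t\<^sub>0"
      using real_arch_pow_inv[OF divide_pos_pos[OF l t\<^sub>0], of "1/2"] by auto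
    thus ?thesis using t\<^sub>0 by (intro exI[of _ n]) (simp add: field_simps power_divide)
  qed
  ultimately show "\<And>l. l > 0 \<Longrightarrow> \<exists>R. inverse_pair (?h + l *\<^sub>R 1) R" by blast
qed

text \<open>The point is that an inverse of \<open>T - z\<close> among the bounded operators is adjointable: its
  adjoint is the inverse of \<open>T - cnj z\<close>, which exists because \<open>cnj z\<close> is not a nonnegative number
  either.\<close>

lemma op_positive_apply_op:
  assumes T: "adjoint_pair T T"
  shows "op_positive ip (apply_op T) \<longleftrightarrow> selfadjoint.pos T"
proof -
  have shift: "(\<lambda>x. apply_op T x - z *\<^sub>C x) = apply_op (T - z *\<^sub>C 1)" for z
    by (auto simp: apply_op_algebra)
  have inv_iff: "inverse_pair S R \<longleftrightarrow> apply_op S \<circ> apply_op R = id \<and> apply_op R \<circ> apply_op S = id" for S R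
    unfolding inverse_pair_def by (metis apply_op_times apply_op_one apply_op_eqI)
  have 1: "alg_spectrum T \<subseteq> op_spectrum ip (apply_op T)"
  proof
    fix z assume z: "z \<in> alg_spectrum T"
    show "z \<in> op_spectrum ip (apply_op T)"
    proof (rule ccontr)
      assume "z \<notin> op_spectrum ip (apply_op T)"
      then obtain f where f: "f \<in> adjointable ip" "apply_op (T - z *\<^sub>C 1) \<circ> f = id"
        "f \<circ> apply_op (T - z *\<^sub>C 1) = id"
        unfolding op_spectrum_def shift by blast
      obtain R where "apply_op R = f" using adjointableE[OF f(1)] by metis
      with f(2,3) have "inverse_pair (T - z *\<^sub>C 1) R" unfolding inv_iff by simp
      with z show False unfolding alg_spectrum_def by blast
    qed
  qed
  have 2: "op_spectrum ip (apply_op T) \<subseteq> complex_of_real ` {0..}" if pos: "selfadjoint.pos T"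
  proof
    fix z assume z: "z \<in> op_spectrum ip (apply_op T)"
    show "z \<in> complex_of_real ` {0..}"
    proof (rule ccontr)
      assume nz: "z \<notin> complex_of_real ` {0..}"
      moreover have "cnj z \<notin> complex_of_real ` {0..}"
      proof
        assume "cnj z \<in> complex_of_real ` {0..}"
        then obtain r where r: "r \<in> {0..}" "cnj z = complex_of_real r" by blast
        hence "z = complex_of_real r" by (metis complex_cnj_cnj complex_cnj_complex_of_real)
        with nz r(1) show False by blast
      qed
      ultimately obtain R Q where RQ: "inverse_pair (T - z *\<^sub>C 1) R" "inverse_pair (T - cnj z *\<^sub>C 1) Q"
        using pos unfolding selfadjoint.pos_def alg_spectrum_def by blast
      have "adjoint_pair (T - z *\<^sub>C 1) (T - cnj z *\<^sub>C 1)"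
        by (intro adjoint_pair_diff adjoint_pair_scaleC adjoint_pair_one T)
      from adjoint_pair_inverse[OF this RQ] have "apply_op R \<in> adjointable ip"
        by (rule adjointableI)
      with RQ(1) z show False unfolding op_spectrum_def shift inv_iff by blast
    qed
  qed
  show ?thesis
    using 1 2 adjointableI[OF T] adj_apply_op[OF T] T
    unfolding op_positive_def selfadjoint.pos_def selfadjoint_ops_iff by (metis order_trans)
qed

lemma op_positiveE:
  assumes "op_positive ip f"
  obtains T where "apply_op T = f" "selfadjoint.pos T"
proof -
  obtain T T' where T: "apply_op T = f" "adjoint_pair T T'"
    using assms adjointableE unfolding op_positive_def by metis
  have "T' = T" using assms adj_apply_op[OF T(2)] T(1) unfolding op_positive_def
    by (metis apply_op_eqI)
  with T assms op_positive_apply_op that show thesis by metis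
qed

text \<open>Let \<open>s\<^sub>0\<close> be the root of \<open>s\<^sup>2 = s'\<^sup>2\<close> that commutes with everything commuting with this square, so in
  particular with \<open>s\<close> and \<open>s'\<close>. It suffices to compare \<open>s\<^sub>0\<close> with a root \<open>k\<close> commuting with it. For
  \<open>d = s\<^sub>0 - k\<close> one has \<open>(s\<^sub>0 + k) d = 0\<close>, so \<open>d s\<^sub>0 d\<close> and \<open>d k d\<close> are positive with sum zero. Hence
  \<open>s\<^sub>0 d = k d = 0\<close> and \<open>d\<^sup>2 = 0\<close>.\<close>

lemma pos_sqrt_unique:
  assumes s: "selfadjoint.pos s" and s': "selfadjoint.pos s'" and eq: "s * s = s' * s'"
  shows "s = s'"
proof -
  have main: "s\<^sub>0 = k" if s\<^sub>0: "selfadjoint.pos s\<^sub>0" and k: "selfadjoint.pos k" and eq: "s\<^sub>0 * s\<^sub>0 = k * k"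
    and comm: "k * s\<^sub>0 = s\<^sub>0 * k" for s\<^sub>0 k
  proof -
    obtain r where r: "selfadjoint.pos r" "r * r = s\<^sub>0" using selfadjoint.pos_sqrt[OF s\<^sub>0] by metis
    obtain r' where r': "selfadjoint.pos r'" "r' * r' = k" using selfadjoint.pos_sqrt[OF k] by metis
    define d where "d = s\<^sub>0 - k"
    have d: "adjoint_pair d d" unfolding d_def by (intro adjoint_pair_diff pos_adjoint_pair s\<^sub>0 k)
    have sum: "s\<^sub>0 * d + k * d = 0" by (simp add: d_def algebra_simps eq comm)
    have rd: "apply_op (r * d) x = 0 \<and> apply_op (r' * d) x = 0" for x
    proof -
      let ?y = "apply_op d x"
      have "ip (apply_op r ?y) (apply_op r ?y) + ip (apply_op r' ?y) (apply_op r' ?y)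
          = ip ?y (apply_op (s\<^sub>0 * d + k * d) x)"
        by (simp add: adjoint_pairD[OF pos_adjoint_pair] r r' apply_op_algebra ip_add_right
            flip: r(2) r'(2))
      hence 0: "ip (apply_op r ?y) (apply_op r ?y) + ip (apply_op r' ?y) (apply_op r' ?y) = 0"
        by (simp add: sum apply_op_algebra)
      have "norm (ip (apply_op r ?y) (apply_op r ?y)) \<le> 0"
        using norm_ip_self_le_add[of "apply_op r ?y" "apply_op r' ?y"] by (simp add: 0)
      hence "ip (apply_op r ?y) (apply_op r ?y) = 0" by simp
      moreover from this 0 have "ip (apply_op r' ?y) (apply_op r' ?y) = 0" by simp
      ultimately show ?thesis using ip_definite by (simp add: apply_op_times)
    qed
    have "r * d = 0" "r' * d = 0" by (rule apply_op_eqI, simp add: rd apply_op_simps)+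
    hence "s\<^sub>0 * d = 0" "k * d = 0" by (simp_all add: mult.assoc flip: r(2) r'(2))
    hence "d * d = 0" by (simp add: d_def left_diff_distrib)
    hence "d = 0" using norm_le_norm_adjoint_times[OF d] by simp
    thus ?thesis by (simp add: d_def)
  qed
  have "selfadjoint.pos (s * s)"
    using pos_adjoint_times_self[OF pos_adjoint_pair[OF s]] .
  then obtain s\<^sub>0 where s\<^sub>0: "selfadjoint.pos s\<^sub>0" "s\<^sub>0 * s\<^sub>0 = s * s"
    "\<And>k. k * (s * s) = (s * s) * k \<Longrightarrow> k * s\<^sub>0 = s\<^sub>0 * k"
    using selfadjoint.pos_sqrt by blast
  have "s\<^sub>0 = s"
    by (rule main[OF s\<^sub>0(1) s s\<^sub>0(2)]) (rule s\<^sub>0(3), simp add: mult.assoc)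
  moreover have "s\<^sub>0 = s'"
    by (rule main[OF s\<^sub>0(1) s' s\<^sub>0(2)[unfolded eq]]) (rule s\<^sub>0(3), simp add: mult.assoc eq)
  ultimately show ?thesis by simp
qed

lemma op_sqrt_square:
  assumes s: "selfadjoint.pos s"
  shows "op_sqrt ip (apply_op (s * s)) = apply_op s"
  unfolding op_sqrt_def
proof (rule the_equality)
  show "op_positive ip (apply_op s) \<and> apply_op s \<circ> apply_op s = apply_op (s * s)"
    using s by (simp add: op_positive_apply_op pos_adjoint_pair apply_op_times)
  fix f assume f: "op_positive ip f \<and> f \<circ> f = apply_op (s * s)"
  then obtain T where T: "apply_op T = f" "selfadjoint.pos T" using op_positiveE by blast
  have "T * T = s * s" using f T(1) by (intro apply_op_eqI) (metis apply_op_times)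
  hence "T = s" using pos_sqrt_unique T(2) s by blast
  thus "f = apply_op s" using T(1) by simp
qed

text \<open>Spectral mapping for \<open>p \<mapsto> p / (p + l)\<close>: a value \<open>r\<close> with \<open>|r| \<ge> 1\<close> in its spectrum would come
  from the negative number \<open>r l / (1 - r)\<close> in the spectrum of \<open>p\<close>, or from infinity if \<open>r = 1\<close>.\<close>

lemma norm_pos_times_inverse_less_one:
  assumes p: "selfadjoint.pos p" and l: "l > 0"
    and w: "inverse_pair (p + l *\<^sub>R 1) w" "adjoint_pair w w"
  shows "norm (p * w) < 1"
proof (cases "p * w = 0")
  case False
  have pw: "p * w = 1 - l *\<^sub>R w"
    using w(1) by (simp add: inverse_pair_def algebra_simps)
  have "p * w \<in> selfadjoint_ops"
    unfolding selfadjoint_ops_iff pw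
    by (intro adjoint_pair_diff adjoint_pair_one adjoint_pair_scaleR w)
  then obtain r where r: "complex_of_real r \<in> alg_spectrum (p * w)" "\<bar>r\<bar> = norm (p * w)"
    using selfadjoint.norm_in_spectrum False by blast
  have fact: "p * w - r *\<^sub>R 1 = ((1 - r) *\<^sub>R p - (r * l) *\<^sub>R 1) * w"
  proof -
    have "p * w - r *\<^sub>R 1 = p * w - r *\<^sub>R ((p + l *\<^sub>R 1) * w)"
      using w(1) by (simp add: inverse_pair_def)
    thus ?thesis by (simp add: algebra_simps)
  qed
  show ?thesis
  proof (rule ccontr)
    assume "\<not> ?thesis"
    with r(2) have r1: "r \<ge> 1 \<or> r \<le> -1" by linarith
    have "\<exists>q. inverse_pair ((1 - r) *\<^sub>R p - (r * l) *\<^sub>R 1) q"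
    proof (cases "r = 1")
      case True
      have "inverse_pair ((- l) *\<^sub>R (1 :: 'h bounded_op)) ((- (1 / l)) *\<^sub>R 1)"
        using l by (simp add: inverse_pair_def)
      thus ?thesis using True by auto
    next
      case r_ne: False
      define m where "m = r * l / (r - 1)"
      have "m > 0"
        using r1
      proof
        assume "r \<ge> 1"
        with r_ne l show ?thesis unfolding m_def by (intro divide_pos_pos mult_pos_pos) auto
      next
        assume "r \<le> -1"
        with l show ?thesis unfolding m_def by (intro divide_neg_neg mult_neg_pos) auto
      qed
      moreover have m: "(1 - r) * m = - (r * l)" using r_ne by (simp add: m_def field_simps)
      ultimately obtain q where "inverse_pair (p + m *\<^sub>R 1) q" using inverse_pair_pos_add[OF p] by blast
      hence "inverse_pair (complex_of_real (1 - r) *\<^sub>C (p + m *\<^sub>R 1)) ((1 / complex_of_real (1 - r)) *\<^sub>C q)"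
        using r_ne by (intro inverse_pair_scaleC) auto
      moreover have "complex_of_real (1 - r) *\<^sub>C (p + m *\<^sub>R 1) = (1 - r) *\<^sub>R p - (r * l) *\<^sub>R 1"
        unfolding scaleC_of_real by (simp add: m scaleR_add_right)
      ultimately show ?thesis by auto
    qed
    then obtain q where "inverse_pair ((1 - r) *\<^sub>R p - (r * l) *\<^sub>R 1) q" ..
    from inverse_pair_mult[OF this inverse_pair_sym[OF w(1)]] r(1) show False
      by (auto simp: alg_spectrum_def scaleC_of_real fact)
  qed
qed simp

text \<open>If the difference is \<open>r\<^sup>2\<close> with \<open>r\<close> self-adjoint, then \<open>\<langle>t x, t x\<rangle> = \<langle>s x, s x\<rangle> + \<langle>r x, r x\<rangle>\<close>, and norms of
  positive elements are monotone. For the converse, let \<open>p = t\<^sup>2\<close>, \<open>l > 0\<close>, and let \<open>w\<close> be the inverse of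
  \<open>p + l\<close>. Then \<open>p - s* s + l = (p + l) (1 - w s* s)\<close> is invertible if \<open>1 - s w s*\<close> is. The domination of \<open>s\<close>
  by \<open>t\<close>, used on both sides of \<open>w\<close> by passing to the adjoint in between, gives
  \<open>\<parallel>s w s*\<parallel> \<le> \<parallel>t w s*\<parallel> = \<parallel>s w t\<parallel> \<le> \<parallel>t w t\<parallel> = \<parallel>p w\<parallel> < 1\<close>. So no inequality between elements of the
  algebra has to be derived from one between their norms.\<close>

lemma norm_le_iff_pos_diff:
  assumes t: "adjoint_pair t t" and ss: "adjoint_pair s s'"
  shows "(\<forall>x. norm (apply_op s x) \<le> norm (apply_op t x)) \<longleftrightarrow> selfadjoint.pos (t * t - s' * s)"
proof
  assume le: "\<forall>x. norm (apply_op s x) \<le> norm (apply_op t x)"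
  define p where "p = t * t"
  have p: "selfadjoint.pos p" unfolding p_def by (rule pos_adjoint_times_self[OF t])
  have times_le: "norm (s * y) \<le> norm (t * y)" for y
  proof (rule norm_op_le)
    fix x
    have "norm (apply_op (s * y) x) \<le> norm (apply_op (t * y) x)"
      using le by (simp add: apply_op_times)
    also have "\<dots> \<le> norm (t * y) * norm x" by (rule norm_apply_op)
    finally show "norm (apply_op (s * y) x) \<le> norm (t * y) * norm x" .
  qed simp
  show "selfadjoint.pos (t * t - s' * s)"
    unfolding p_def[symmetric]
  proof (rule pos_if_inverses)
    show "adjoint_pair (p - s' * s) (p - s' * s)"
      unfolding p_def by (intro adjoint_pair_diff adjoint_pair_times t ss adjoint_pair_sym[OF ss])
    fix l :: real assume l: "l > 0"
    then obtain w where w: "inverse_pair (p + l *\<^sub>R 1) w" "adjoint_pair w w"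
      using inverse_pair_pos_add[OF p] by blast
    have tw: "t * w = w * t"
    proof -
      have "t * w = w * (p + l *\<^sub>R 1) * t * w" using w(1) by (simp add: inverse_pair_def)
      also have "\<dots> = w * t * ((p + l *\<^sub>R 1) * w)" by (simp add: p_def algebra_simps)
      finally show ?thesis using w(1) by (simp add: inverse_pair_def)
    qed
    have "norm (s * (w * s')) \<le> norm (t * (w * s'))" by (rule times_le)
    also have "\<dots> = norm (s * (w * t))"
      using norm_adjoint[OF adjoint_pair_times[OF t adjoint_pair_times[OF w(2) adjoint_pair_sym[OF ss]]]]
      by (simp add: mult.assoc)
    also have "\<dots> \<le> norm (t * (w * t))" by (rule times_le)
    also have "t * (w * t) = p * w" by (simp add: p_def mult.assoc flip: tw)
    also have "norm (p * w) < 1" by (rule norm_pos_times_inverse_less_one[OF p l w])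
    finally obtain c where "inverse_pair (1 - s * (w * s')) c" using inverse_pair_one_minus by blast
    hence inv: "inverse_pair ((p + l *\<^sub>R 1) * (1 - w * s' * s)) ((1 + w * s' * c * s) * w)"
      by (intro inverse_pair_mult[OF w(1)] inverse_pair_one_minus_swap)
    have "(p + l *\<^sub>R 1) * (1 - w * s' * s) = (p + l *\<^sub>R 1) - ((p + l *\<^sub>R 1) * w) * (s' * s)"
      by (simp add: right_diff_distrib mult.assoc)
    also have "\<dots> = p - s' * s + l *\<^sub>R 1" using w(1) by (simp add: inverse_pair_def)
    finally show "\<exists>R. inverse_pair (p - s' * s + l *\<^sub>R 1) R" using inv by metis
  qed
next
  assume "selfadjoint.pos (t * t - s' * s)"
  then obtain r where r: "selfadjoint.pos r" "r * r = t * t - s' * s"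
    using selfadjoint.pos_sqrt by metis
  show "\<forall>x. norm (apply_op s x) \<le> norm (apply_op t x)"
  proof
    fix x
    have "ip (apply_op s x) (apply_op s x) + ip (apply_op r x) (apply_op r x)
        = ip x (apply_op (s' * s + r * r) x)"
      by (simp add: adjoint_pairD[OF ss] adjoint_pairD[OF pos_adjoint_pair[OF r(1)]]
          apply_op_times apply_op_simps ip_add_right)
    also have "\<dots> = ip (apply_op t x) (apply_op t x)"
      by (simp add: r(2) adjoint_pairD[OF t] apply_op_times)
    finally have "(norm (apply_op s x))\<^sup>2 \<le> (norm (apply_op t x))\<^sup>2"
      using norm_ip_self_le_add by (metis norm_ip_self)
    thus "norm (apply_op s x) \<le> norm (apply_op t x)" by (rule power2_le_imp_le) simp
  qed
qed

text \<open>Here \<open>t\<close> is the square root of \<open>|A|\<close>. Let \<open>b = |A|\<close> and \<open>e = U* U\<close>. Since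
  \<open>b e b = A* A = b\<^sup>2\<close> and \<open>e\<close> is a projection, \<open>((1 - e) b)* ((1 - e) b) = b (1 - e) b = 0\<close>, so \<open>e b = b\<close>.
  Therefore \<open>(U b U*)\<^sup>2 = U b\<^sup>2 U* = A A*\<close>, and \<open>U b U*\<close> is positive, which identifies it as \<open>|A*|\<close>.\<close>

lemma polar_decompositionE:
  assumes A: "A \<in> adjointable ip" and polar: "polar_decomposition ip A U"
  obtains t u u' where "selfadjoint.pos t" "adjoint_pair u u'"
    "op_abs ip A = apply_op (t * t)" "op_sqrt ip (op_abs ip A) = apply_op t"
    "op_abs ip (adj ip A) = apply_op (u * t * (t * u'))" "A = apply_op (u * (t * t))"
proof -
  obtain a a' where a: "apply_op a = A" "adjoint_pair a a'" using adjointableE[OF A] by blast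
  have adjA: "adj ip A = apply_op a'" "adj ip (apply_op a') = A"
    using a adj_apply_op adjoint_pair_sym by blast+
  obtain b where b: "selfadjoint.pos b" "b * b = a' * a"
    using selfadjoint.pos_sqrt[OF pos_adjoint_times_self[OF a(2)]] by metis
  have abs_A: "op_abs ip A = apply_op b"
    unfolding op_abs_def adjA a(1)[symmetric] adj_apply_op[OF a(2)] apply_op_times[symmetric]
    by (simp add: op_sqrt_square[OF b(1)] flip: b(2))
  obtain t where t: "selfadjoint.pos t" "t * t = b" using selfadjoint.pos_sqrt[OF b(1)] by metis
  have sqrt_abs: "op_sqrt ip (op_abs ip A) = apply_op t"
    unfolding abs_A t(2)[symmetric] by (rule op_sqrt_square[OF t(1)])
  have U: "A = U \<circ> op_abs ip A" "U \<in> adjointable ip" "projection ip (adj ip U \<circ> U)"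
    using polar unfolding polar_decomposition_def partial_isometry_def by blast+
  obtain u u' where u: "apply_op u = U" "adjoint_pair u u'" using adjointableE[OF U(2)] by blast
  have "apply_op a = apply_op (u * b)"
    unfolding a(1) apply_op_times u(1) by (rule U(1)[unfolded abs_A])
  hence a_eq: "a = u * b" by (intro apply_op_eqI) simp
  have "adjoint_pair a (b * u')" unfolding a_eq by (intro adjoint_pair_times u pos_adjoint_pair b)
  hence a'_eq: "a' = b * u'" using a(2) adjoint_unique by blast
  define e where "e = u' * u"
  have "adj ip U \<circ> U = apply_op e"
    unfolding e_def apply_op_times u(1)[symmetric] adj_apply_op[OF u(2)] ..
  hence "apply_op e \<circ> apply_op e = apply_op e" using U(3) unfolding projection_def by simp
  hence ee: "e * e = e" by (intro apply_op_eqI) (simp add: apply_op_times)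
  have e_adj: "adjoint_pair e e" unfolding e_def by (intro adjoint_pair_times u adjoint_pair_sym[OF u(2)])
  have "b * e * b = b * b" by (simp add: b(2) a_eq a'_eq e_def mult.assoc)
  hence "(b * (1 - e)) * ((1 - e) * b) = 0"
    by (simp add: algebra_simps) (simp add: ee flip: mult.assoc)
  moreover have "adjoint_pair ((1 - e) * b) (b * (1 - e))"
    by (intro adjoint_pair_times adjoint_pair_diff adjoint_pair_one e_adj pos_adjoint_pair b)
  ultimately have "(1 - e) * b = 0" using norm_le_norm_adjoint_times by fastforce
  hence eb: "e * b = b" by (simp add: left_diff_distrib)
  define q where "q = u * t * (t * u')"
  have "adjoint_pair (t * u') (u * t)"
    by (intro adjoint_pair_times adjoint_pair_sym[OF u(2)] pos_adjoint_pair t)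
  hence q: "selfadjoint.pos q" unfolding q_def by (rule pos_adjoint_times_self)
  have "q = u * b * u'" by (simp add: q_def mult.assoc flip: t(2))
  hence "q * q = u * b * (e * b) * u'" by (simp add: e_def mult.assoc)
  also have "\<dots> = a * a'" by (simp add: eb a_eq a'_eq mult.assoc)
  finally have qq: "q * q = a * a'" .
  have "op_abs ip (adj ip A) = op_sqrt ip (apply_op (q * q))"
    unfolding op_abs_def adjA qq apply_op_times a(1) ..
  hence abs_adjA: "op_abs ip (adj ip A) = apply_op q" by (simp only: op_sqrt_square[OF q])
  show thesis
  proof (rule that[OF t(1) u(2) _ sqrt_abs abs_adjA[unfolded q_def]])
    show "op_abs ip A = apply_op (t * t)" unfolding t(2) by (rule abs_A)
    show "A = apply_op (u * (t * t))" unfolding t(2) a_eq[symmetric] by (rule a(1)[symmetric])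
  qed
qed

end

section \<open>Semi-hyponormality and the mixed Schwarz inequality\<close>

theorem theorem2p26:
  fixes act :: "'h::{complex_normed_vector, banach} \<Rightarrow> 'a::cstar_algebra \<Rightarrow> 'h"
    and ip :: "'h \<Rightarrow> 'h \<Rightarrow> 'a"
    and A U :: "'h \<Rightarrow> 'h"
  assumes "hilbert_module act ip"
    and "A \<in> adjointable ip"
    and "polar_decomposition ip A U"
  shows "semi_hyponormal ip A \<longleftrightarrow>
    (\<forall>x y. norm (ip (A x) y)
       \<le> norm (op_sqrt ip (op_abs ip A) x) * norm (op_sqrt ip (op_abs ip A) y))"
proof -
  interpret hilbert_module act ip by fact
  obtain t u u' where t: "selfadjoint.pos t" and u: "adjoint_pair u u'"
    and eqs: "op_abs ip A = apply_op (t * t)" "op_sqrt ip (op_abs ip A) = apply_op t"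
      "op_abs ip (adj ip A) = apply_op (u * t * (t * u'))" "A = apply_op (u * (t * t))"
    by (rule polar_decompositionE[OF assms(2,3)])
  have tt: "adjoint_pair t t" using t by (rule pos_adjoint_pair)
  have v: "adjoint_pair (t * u') (u * t)"
    by (intro adjoint_pair_times adjoint_pair_sym[OF u] tt)
  have 1: "adjoint_pair (t * t) (t * t)" "adjoint_pair (u * t * (t * u')) (u * t * (t * u'))"
    using adjoint_pair_times tt v adjoint_pair_sym by blast+
  have "semi_hyponormal ip A \<longleftrightarrow> op_positive ip (apply_op (t * t - u * t * (t * u')))"
    unfolding semi_hyponormal_def op_le_def eqs(1,3)
    using adjointableI[OF 1(1)] adjointableI[OF 1(2)] by (simp flip: apply_op_simps)
  also have "\<dots> \<longleftrightarrow> selfadjoint.pos (t * t - u * t * (t * u'))"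
    by (intro op_positive_apply_op adjoint_pair_diff 1)
  also have "\<dots> \<longleftrightarrow> (\<forall>y. norm (apply_op (t * u') y) \<le> norm (apply_op t y))"
    using norm_le_iff_pos_diff[OF tt v] by simp
  also have "\<dots> \<longleftrightarrow> (\<forall>x y. norm (ip (A x) y) \<le> norm (apply_op t x) * norm (apply_op t y))"
  proof -
    have ipA: "ip (A x) y = ip (apply_op t x) (apply_op (t * u') y)" for x y
      by (simp add: eqs(4) apply_op_times adjoint_pairD[OF u] adjoint_pairD[OF tt])
    show ?thesis
    proof (intro iffI allI)
      fix x y
      assume le: "\<forall>y. norm (apply_op (t * u') y) \<le> norm (apply_op t y)"
      have "norm (ip (A x) y) \<le> norm (apply_op t x) * norm (apply_op (t * u') y)"
        unfolding ipA by (rule Cauchy_Schwarz)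
      also have "\<dots> \<le> norm (apply_op t x) * norm (apply_op t y)"
        using le by (intro mult_left_mono) auto
      finally show "norm (ip (A x) y) \<le> norm (apply_op t x) * norm (apply_op t y)" .
    next
      fix y
      assume "\<forall>x y. norm (ip (A x) y) \<le> norm (apply_op t x) * norm (apply_op t y)"
      \<comment> \<open>At \<open>x = U* y\<close> both \<open>T x\<close> and the second factor of \<open>\<langle>A x, y\<rangle>\<close> are \<open>T U* y\<close>.\<close>
      hence "norm (ip (A (apply_op u' y)) y) \<le> norm (apply_op t (apply_op u' y)) * norm (apply_op t y)"
        by blast
      hence "norm (apply_op (t * u') y) * norm (apply_op (t * u') y)
          \<le> norm (apply_op (t * u') y) * norm (apply_op t y)"
        unfolding ipA by (simp add: apply_op_times norm_ip_self power2_eq_square)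
      thus "norm (apply_op (t * u') y) \<le> norm (apply_op t y)"
        by (cases "norm (apply_op (t * u') y) = 0") auto
    qed
  qed
  finally show ?thesis unfolding eqs(2) .
qed

end
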